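(* Consider the sequence of models described in the context, and let $\mathbf{u}_0\in\mathbb{R}^{n+p}$ be the vector whose first $n$ entries are $1$ and whose last $p$ entries are $0$. Assume that the eigenvalues of $\boldsymbol\Sigma$ are bounded away from $0$ and $\infty$ (uniformly in $n$), that $n^{1/C}\le p\le n^{C}$ for some constant $C>0$, that $d_1\gg\sigma_n$, and that $d_1/d_2\ge 1+c$ for some positive constant $c$ (the case $d_2=0$ is allowed). Then for any positive constant $D$ there is a constant $n_0$, depending only on $D$, such that for all $n\ge n_0$ $$\mathbb{P}\left(\frac{\widehat t_1}{\widehat t_2}\ge 1+\frac c2\right)\ge 1-n^{-D}.$$ Moreover, if the first $n$ entries of $\mathbf{v}_1$ are equal, then for all $n\ge n_0$ $$\mathbb{P}\left(\left|\left(\frac1n\right)^{1/2}\big|\mathbf{u}_0^\top\widehat{\mathbf{v}}_1\big|-\left(\frac12\right)^{1/2}\right|\le\sqrt{\frac{2\sigma_n}{d_1}}\right)\ge 1-n^{-D}.$$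
   Context: A sequence of models indexed by $n$ is fixed: for each $n$, $\mathbf{X}=(\mathbf{x}_1,\dots,\mathbf{x}_n)$ is a $p\times n$ random matrix with $\mathbf{x}_i=Y_i\boldsymbol\mu_1+(1-Y_i)\boldsymbol\mu_2+\mathbf{w}_i$, where $Y_1,\dots,Y_n\in\{0,1\}$ are deterministic, $\boldsymbol\mu_1\ne\boldsymbol\mu_2$, $\boldsymbol\mu_2\neq0$ are deterministic vectors in $\mathbb{R}^p$, and $\mathbf{w}_1,\dots,\mathbf{w}_n$ are i.i.d. $\mathcal{N}(\mathbf{0},\boldsymbol\Sigma)$; $p,\boldsymbol\mu_1,\boldsymbol\mu_2,\boldsymbol\Sigma,Y_i$ may depend on $n$. Put $\sigma_n^2=\|\boldsymbol\Sigma\|^2(n+p)$ (spectral norm, $\sigma_n>0$). $d_1\ge d_2\ge0$ are the two largest singular values of $\mathbb{E}\mathbf{X}$ (which has rank at most 2), and $\widehat t_1\ge\widehat t_2\ge0$ are the two largest singular values of $\mathbf{X}$. Let $\mathcal{Z}=\begin{pmatrix}0&\mathbf{X}^\top\\ \mathbf{X}&0\end{pmatrix}$, an $(n+p)\times(n+p)$ symmetric matrix whose two largest eigenvalues are $\widehat t_1,\widehat t_2$; $\widehat{\mathbf{v}}_1$ is a unit eigenvector of $\mathcal{Z}$ for $\widehat t_1$, and $\mathbf{v}_1$ is a unit eigenvector of $\mathbb{E}\mathcal{Z}$ for its largest eigenvalue $d_1$. For positive sequences, $u_n\gg v_n$ means $u_n/v_n\to\infty$. *)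

theory Defs
  imports "HOL-Probability.Probability" "Jordan_Normal_Form.Char_Poly"
begin

unbundle no vec_syntax and no inner_syntax

definition vec_l2 :: "real vec \<Rightarrow> real" where
  "vec_l2 v = sqrt (v \<bullet> v)"

text \<open>The unit ball rather than the unit sphere keeps the set nonempty in dimension 0.\<close>

definition spectral_norm :: "real mat \<Rightarrow> real" where
  "spectral_norm A =
     (SUP x \<in> {x \<in> carrier_vec (dim_col A). vec_l2 x \<le> 1}. vec_l2 (A *\<^sub>v x))"

text \<open>The square roots of the eigenvalues of $A^T A$ with multiplicity, in decreasing order.
  The matrix $A^T A$ is symmetric, so its real characteristic polynomial splits over the reals.\<close>

definition singular_values :: "real mat \<Rightarrow> real list" where
  "singular_values A =
     rev (sorted_list_of_multiset (image_mset sqrt (proots (char_poly (transpose_mat A * A)))))"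

text \<open>The index \<open>k\<close> starts at 1; a matrix with fewer than \<open>k\<close> columns
  gets the singular value 0.\<close>

definition singular_value :: "real mat \<Rightarrow> nat \<Rightarrow> real" where
  "singular_value A k =
     (if 1 \<le> k \<and> k \<le> length (singular_values A) then singular_values A ! (k - 1) else 0)"

definition symmetric_dilation :: "real mat \<Rightarrow> real mat" where
  "symmetric_dilation A =
     four_block_mat (0\<^sub>m (dim_col A) (dim_col A)) (transpose_mat A)
                    A (0\<^sub>m (dim_row A) (dim_row A))"

definition expectation_mat :: "'a measure \<Rightarrow> nat \<Rightarrow> nat \<Rightarrow> ('a \<Rightarrow> real mat) \<Rightarrow> real mat" where
  "expectation_mat M r s A = Matrix.mat r s (\<lambda>(i, j). \<integral>\<omega>. A \<omega> $$ (i, j) \<partial>M)"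

definition normal_law :: "real \<Rightarrow> real \<Rightarrow> real measure" where
  "normal_law m v = (if v = 0 then return borel m else density lborel (normal_density m (sqrt v)))"

text \<open>The law $N(m, S)$ on column vectors of dimension \<open>p\<close>: every linear functional
  is normal with the corresponding mean and variance. The covariance \<open>S\<close> may be singular.\<close>

definition gaussian_vector ::
  "'a measure \<Rightarrow> nat \<Rightarrow> real vec \<Rightarrow> real mat \<Rightarrow> ('a \<Rightarrow> real vec) \<Rightarrow> bool" where
  "gaussian_vector M p m S W \<longleftrightarrow>
     m \<in> carrier_vec p \<and> S \<in> carrier_mat p p \<and> transpose_mat S = S \<and>
     (\<forall>a \<in> carrier_vec p. 0 \<le> a \<bullet> (S *\<^sub>v a)) \<and>
     (\<forall>\<omega> \<in> space M. W \<omega> \<in> carrier_vec p) \<and>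
     (\<forall>a \<in> carrier_vec p.
        (\<lambda>\<omega>. a \<bullet> W \<omega>) \<in> borel_measurable M \<and>
        distr M borel (\<lambda>\<omega>. a \<bullet> W \<omega>) = normal_law (a \<bullet> m) (a \<bullet> (S *\<^sub>v a)))"

text \<open>Vectors of type \<open>real vec\<close> carry no sigma-algebra, so independence is stated for
  the tuples of coordinates in the product space.\<close>

definition iid_gaussian_noise ::
  "'a measure \<Rightarrow> nat \<Rightarrow> nat \<Rightarrow> real mat \<Rightarrow> (nat \<Rightarrow> 'a \<Rightarrow> real vec) \<Rightarrow> bool" where
  "iid_gaussian_noise M n p S w \<longleftrightarrow>
     (\<forall>i < n. gaussian_vector M p (0\<^sub>v p) S (w i)) \<and>
     prob_space.indep_vars M (\<lambda>_. Pi\<^sub>M {..<p} (\<lambda>_. borel))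
       (\<lambda>i \<omega>. \<lambda>k \<in> {..<p}. w i \<omega> $ k) {..<n}"

text \<open>The $p \times n$ matrix with columns $x_i = Y_i \mu_1 + (1 - Y_i) \mu_2 + w_i$;
  samples are indexed from 0.\<close>

definition data_matrix ::
  "nat \<Rightarrow> nat \<Rightarrow> (nat \<Rightarrow> real) \<Rightarrow> real vec \<Rightarrow> real vec \<Rightarrow> (nat \<Rightarrow> 'a \<Rightarrow> real vec) \<Rightarrow> 'a \<Rightarrow> real mat" where
  "data_matrix n p Y \<mu>1 \<mu>2 w \<omega> =
     mat_of_cols p (map (\<lambda>i. Y i \<cdot>\<^sub>v \<mu>1 + (1 - Y i) \<cdot>\<^sub>v \<mu>2 + w i \<omega>) [0..<n])"

definition block_indicator :: "nat \<Rightarrow> nat \<Rightarrow> real vec" where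
  "block_indicator n p = Matrix.vec (n + p) (\<lambda>i. if i < n then 1 else 0)"

definition unit_eigenvector :: "real mat \<Rightarrow> real vec \<Rightarrow> real \<Rightarrow> bool" where
  "unit_eigenvector A v k \<longleftrightarrow> eigenvector A v k \<and> vec_l2 v = 1"

text \<open>The ratio of two nonnegative reals as an extended real, so that $a/0 = \infty$ for $a > 0$
  (and $0/0 = 0$).\<close>

definition ext_ratio :: "real \<Rightarrow> real \<Rightarrow> ereal" where
  "ext_ratio a b = ereal a / ereal b"

end

theory Submission
  imports Defs "HOL-Real_Asymp.Real_Asymp"
begin

text \<open>Write \<open>X = E X + W\<close>. A union bound over a lattice net of \<open>exp (O (n + p))\<close> points, with Gaussian tails for
  the bilinear forms \<open>y\<^sup>T W x\<close>, gives \<open>|W| \<le> K \<sigma>\<^sub>n\<close> outside an event of probability \<open>exp (- (n + p))\<close>.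
  By Weyl's inequality the singular values then move by at most \<open>K \<sigma>\<^sub>n = o(d\<^sub>1)\<close>, which gives the ratio bound.
  If the first \<open>n\<close> entries of \<open>v\<^sub>1\<close> agree, that block is \<open>\<plusminus> u\<^sub>0 / \<surd>(2n)\<close>; a Davis--Kahan argument for the right
  singular vectors shows that the overlap with \<open>u\<^sub>0\<close> is deficient by at most \<open>O(\<sigma>\<^sub>n / d\<^sub>1)\<close>, which is
  eventually below \<open>\<surd>(2 \<sigma>\<^sub>n / d\<^sub>1)\<close>.\<close>

section \<open>The spectral theorem for real symmetric matrices\<close>

text \<open>Singular values are defined as sorted roots of a characteristic polynomial and so come
  without vectors. The spectral theorem attaches an orthonormal eigenbasis of \<open>A^T A\<close>
  to them, and what is used afterwards is small: the top two right singular vectors, and a bound by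
  the second singular value on the complement of the first. The bilinear form \<open>y . W x\<close>
  has variance at most \<open>|S| |x|^2 |y|^2\<close>, so the natural size of \<open>|W|\<close> is
  \<open>sqrt (|S| (n + p))\<close>, whereas \<sigma> is \<open>|S| sqrt (n + p)\<close>. A lower
  bound \<open>a\<close> on the eigenvalues gives \<open>a <= |S|\<close>, hence the first quantity
  is at most \<sigma> divided by \<open>sqrt a\<close>; this is why \<open>K\<close> depends on
  \<open>a\<close>. The spectrum of the dilation is symmetric about 0. Working with right singular
  vectors instead of its eigenvectors avoids the negative half: the energy \<open>|A x|^2\<close>
  sees only the gap between \<open>d1\<close> and \<open>d2\<close>. All the probability is in one
  event on which \<open>|W|\<close> is small; on it both claims are deterministic.\<close>

lemma symmetric_complex_eigenvalue_real:
  fixes A :: "real mat"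
  assumes A: "A \<in> carrier_mat n n" "transpose_mat A = A"
    and ev: "eigenvalue (map_mat complex_of_real A) a"
  shows "a \<in> \<real>"
proof -
  let ?C = "map_mat complex_of_real A"
  have C: "?C \<in> carrier_mat n n" using A by simp
  obtain v where v: "v \<in> carrier_vec n" "v \<noteq> 0\<^sub>v n" "?C *\<^sub>v v = a \<cdot>\<^sub>v v"
    using ev C unfolding eigenvalue_def eigenvector_def by auto
  have cv: "conjugate v \<in> carrier_vec n" using v by simp
  have tC: "transpose_mat ?C = ?C" using A(2)
    by (metis map_mat_transpose)
  have conjC: "?C *\<^sub>v conjugate v = conjugate (?C *\<^sub>v v)"
  proof (rule eq_vecI)
    fix i assume "i < dim_vec (conjugate (?C *\<^sub>v v))"
    then have i: "i < n" using C by simp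
    show "(?C *\<^sub>v conjugate v) $ i = conjugate (?C *\<^sub>v v) $ i"
      using i A v(1) by (simp add: scalar_prod_def)
  qed (use C in simp)
  have "a * (v \<bullet> conjugate v) = (?C *\<^sub>v v) \<bullet> conjugate v"
    using v cv by simp
  also have "\<dots> = v \<bullet> (?C *\<^sub>v conjugate v)"
    using transpose_vec_mult_scalar[OF C cv v(1)] tC by simp
  also have "\<dots> = v \<bullet> (cnj a \<cdot>\<^sub>v conjugate v)"
    unfolding conjC v(3) by (simp add: conjugate_smult_vec)
  also have "\<dots> = cnj a * (v \<bullet> conjugate v)"
    using v cv by simp
  finally have "a = cnj a"
    using conjugate_square_eq_0_vec[OF v(1)] v(2) by simp
  then show ?thesis by (simp add: Reals_cnj_iff)
qed

text \<open>The factorisation exists over the complex numbers, where all roots are real by the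
  previous lemma; the embedding of real into complex polynomials is injective, so it
  descends.\<close>

lemma symmetric_char_poly_splits:
  fixes A :: "real mat"
  assumes A: "A \<in> carrier_mat n n" "transpose_mat A = A"
  obtains es where "char_poly A = (\<Prod>e\<leftarrow>es. [:- e, 1:])" "length es = n"
proof -
  interpret ph: map_poly_inj_idom_hom complex_of_real ..
  let ?C = "map_mat complex_of_real A"
  have C: "?C \<in> carrier_mat n n" using A by simp
  obtain as where as: "char_poly ?C = (\<Prod>a\<leftarrow>as. [:- a, 1:])" "length as = n"
    using char_poly_factorized[OF C] by auto
  have real: "a \<in> \<real>" if "a \<in> set as" for a
  proof -
    have "poly (char_poly ?C) a = 0"
      unfolding as(1) using that by (auto simp: poly_prod_list prod_list_zero_iff)
    then show ?thesis
      using symmetric_complex_eigenvalue_real[OF A] eigenvalue_root_char_poly[OF C] by auto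
  qed
  let ?es = "map Re as"
  have as_es: "map complex_of_real ?es = as"
    using real by (auto intro: map_idI)
  have "map_poly complex_of_real (char_poly A) = char_poly ?C"
    by (simp add: of_real_hom.char_poly_hom[OF A(1)])
  also have "\<dots> = (\<Prod>e\<leftarrow>?es. [:- complex_of_real e, 1:])"
    unfolding as(1) by (subst as_es[symmetric]) (simp add: o_def)
  also have "\<dots> = map_poly complex_of_real (\<Prod>e\<leftarrow>?es. [:- e, 1:])"
    by (simp add: ph.hom_prod_list o_def)
  finally have "char_poly A = (\<Prod>e\<leftarrow>?es. [:- e, 1:])"
    by (rule ph.injectivity)
  then show ?thesis using as(2) by (intro that[of ?es]) simp_all
qed

text \<open>The reflection in the hyperplane orthogonal to \<open>unit_vec n 0 - v\<close> exchanges
  the two unit vectors. It is undefined when they coincide, and the identity serves there.\<close>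

lemma householder:
  fixes v :: "real vec"
  assumes v: "v \<in> carrier_vec n" "v \<bullet> v = 1" "0 < n"
  obtains H where "H \<in> carrier_mat n n" "transpose_mat H = H" "H * H = 1\<^sub>m n"
    "H *\<^sub>v unit_vec n 0 = v"
proof (cases "v = unit_vec n 0")
  case True
  then show ?thesis using that[of "1\<^sub>m n"] by simp
next
  case False
  define u where "u = unit_vec n 0 - v"
  define s where "s = 2 / (u \<bullet> u)"
  have u: "u \<in> carrier_vec n" using v by (simp add: u_def)
  have uu: "u \<bullet> u \<noteq> 0"
  proof
    assume "u \<bullet> u = 0"
    then have "u = 0\<^sub>v n" using conjugate_square_eq_0_vec[OF u] by simp
    then have "unit_vec n 0 = v"
      using v by (auto simp: u_def vec_eq_iff)
    then show False using False by simp
  qed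
  \<comment> \<open>Both vectors are unit, so \<open>|u|^2 = 2 - 2 v_0\<close>. Hence
    \<open>s * u $ 0 = 1\<close>, which makes column 0 of \<open>H\<close> equal to
    \<open>v\<close>.\<close>
  have uu_eq: "u \<bullet> u = 2 * (u $ 0)"
    unfolding u_def using v
    by (simp add: minus_scalar_prod_distrib[of _ n] scalar_prod_minus_distrib[of _ n])
  define H where "H = Matrix.mat n n (\<lambda>(i,j). (if i = j then 1 else 0) - s * u $ i * u $ j)"
  have H: "H \<in> carrier_mat n n" by (simp add: H_def)
  have "H * H = 1\<^sub>m n"
  proof (rule eq_matI)
    fix i j assume "i < dim_row (1\<^sub>m n)" "j < dim_col (1\<^sub>m n)"
    then have ij: "i < n" "j < n" by auto
    have "(H * H) $$ (i,j) = (\<Sum>k = 0..<n. ((if i = k then 1 else 0) - s * u $ i * u $ k)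
        * ((if k = j then 1 else 0) - s * u $ k * u $ j))"
      using ij by (simp add: H_def scalar_prod_def)
    also have "\<dots> = (\<Sum>k = 0..<n. (if k = i then (if i = j then 1 else 0) else 0)
       - (if k = i then s * u $ i * u $ j else 0) - (if k = j then s * u $ i * u $ j else 0)
       + s^2 * u $ i * u $ j * (u $ k * u $ k))"
      by (intro sum.cong refl) (simp add: algebra_simps power2_eq_square)
    also have "\<dots> = (if i = j then 1 else 0) - 2 * s * u $ i * u $ j
       + s^2 * u $ i * u $ j * (u \<bullet> u)"
      using ij u by (simp add: sum.distrib sum_subtractf sum_distrib_left scalar_prod_def)
    also have "s^2 * u $ i * u $ j * (u \<bullet> u) = 2 * s * u $ i * u $ j"
      using uu by (simp add: s_def power2_eq_square)
    finally show "(H * H) $$ (i,j) = 1\<^sub>m n $$ (i,j)" using ij by simp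
  qed (simp_all add: H_def)
  moreover have "H *\<^sub>v unit_vec n 0 = v"
  proof (rule eq_vecI)
    fix i assume "i < dim_vec v"
    then have i: "i < n" using v by simp
    have "(H *\<^sub>v unit_vec n 0) $ i = (if i = 0 then 1 else 0) - s * u $ i * u $ 0"
      using i v(3) H by (simp add: H_def)
    also have "s * u $ i * u $ 0 = u $ i"
      using uu uu_eq by (simp add: s_def)
    also have "u $ i = (if i = 0 then 1 else 0) - v $ i"
      using i v unfolding u_def by (simp add: unit_vec_def)
    finally show "(H *\<^sub>v unit_vec n 0) $ i = v $ i" by simp
  qed (use v H in simp)
  moreover have "transpose_mat H = H"
    by (rule eq_matI) (auto simp: H_def)
  ultimately show ?thesis
    using that[of H] H by blast
qed

text \<open>Deflation by induction on the list of roots: a reflection carries the first basis vector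
  to an eigenvector of the head, and the remaining block has the tail as its roots. Since the list
  is a parameter, the eigenvalues can be requested in any order, in particular sorted.\<close>

theorem symmetric_spectral_decomposition:
  fixes A :: "real mat"
  assumes "A \<in> carrier_mat n n" "transpose_mat A = A" "char_poly A = (\<Prod>e\<leftarrow>es. [:- e, 1:])"
  shows "\<exists>U \<in> carrier_mat n n. transpose_mat U * U = 1\<^sub>m n \<and> A * U = U * mat_diag n ((!) es)"
  using assms
proof (induction es arbitrary: A n)
  case Nil
  have "n = 0"
    using degree_monic_char_poly[OF Nil(1)] Nil(3) by simp
  then show ?case using Nil(1) by (intro bexI[of _ "1\<^sub>m n"]) (auto simp: mat_diag_def)
next
  case (Cons e es A n)
  note A = Cons.prems(1,2)
  have "n = length (e # es)"
    using degree_monic_char_poly[OF A(1)] Cons.prems(3) degree_linear_factors[of uminus "e # es"]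
    by simp
  then obtain m where n: "n = Suc m" by simp
  have "poly (char_poly A) e = 0" using Cons.prems(3) by simp
  then obtain w where w: "w \<in> carrier_vec n" "w \<noteq> 0\<^sub>v n" "A *\<^sub>v w = e \<cdot>\<^sub>v w"
    using eigenvalue_root_char_poly[OF A(1)] A unfolding eigenvalue_def eigenvector_def by auto
  have ww: "w \<bullet> w > 0" using conjugate_square_greater_0_vec[OF w(1)] w(2) by simp
  define v where "v = (1 / sqrt (w \<bullet> w)) \<cdot>\<^sub>v w"
  have v: "v \<in> carrier_vec n" "v \<bullet> v = 1" "A *\<^sub>v v = e \<cdot>\<^sub>v v"
    using w ww A by (auto simp: v_def mult_mat_vec[OF A(1)] smult_smult_assoc mult.commute)
  obtain H where H: "H \<in> carrier_mat n n" "transpose_mat H = H" "H * H = 1\<^sub>m n"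
    "H *\<^sub>v unit_vec n 0 = v"
    using householder[OF v(1,2)] n by blast
  \<comment> \<open>Because \<open>H\<close> is a symmetric involution, \<open>B\<close> is both
    similar to \<open>A\<close> and symmetric; the zeros in its column 0 therefore reappear in row
    0.\<close>
  define B where "B = H * A * H"
  have B: "B \<in> carrier_mat n n" using H A by (simp add: B_def)
  have tB: "transpose_mat B = B"
    using H A unfolding B_def by (simp add: transpose_mult[of _ n n _ n])
  have HB: "A * H = H * B"
    using H A unfolding B_def
    by (simp add: assoc_mult_mat[symmetric, of _ n n _ n _ n] del: assoc_mult_mat)
  have colB: "col B 0 = e \<cdot>\<^sub>v unit_vec n 0"
  proof -
    have Hv: "H *\<^sub>v v = unit_vec n 0"
      using H assoc_mult_mat_vec[of H n n H n "unit_vec n 0"] by simp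
    have "col B 0 = B *\<^sub>v unit_vec n 0"
      using B n by (intro eq_vecI) auto
    also have "\<dots> = H *\<^sub>v (A *\<^sub>v (H *\<^sub>v unit_vec n 0))"
      using H(1) A(1) by (simp add: B_def assoc_mult_mat_vec[of _ n n _ n] del: assoc_mult_mat)
    also have "\<dots> = e \<cdot>\<^sub>v unit_vec n 0"
      using H v Hv by (simp add: mult_mat_vec[OF H(1)])
    finally show ?thesis .
  qed
  have B0: "B $$ (i, 0) = (if i = 0 then e else 0)" "B $$ (0, i) = (if i = 0 then e else 0)"
    if "i < n" for i
  proof -
    show *: "B $$ (i, 0) = (if i = 0 then e else 0)"
      using arg_cong[OF colB, of "\<lambda>v. v $ i"] that B n by simp
    show "B $$ (0, i) = (if i = 0 then e else 0)"
      using * tB that B n by (metis carrier_matD index_transpose_mat(1) zero_less_Suc)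
  qed
  define E where "E = Matrix.mat 1 1 (\<lambda>_. e)"
  define A' where "A' = Matrix.mat m m (\<lambda>(i,j). B $$ (Suc i, Suc j))"
  have E: "E \<in> carrier_mat 1 1" and A': "A' \<in> carrier_mat m m" by (auto simp: E_def A'_def)
  have Bb: "B = four_block_mat E (0\<^sub>m 1 m) (0\<^sub>m m 1) A'"
    using B n B0 by (intro eq_matI) (auto simp: E_def A'_def)
  have tA': "transpose_mat A' = A'"
    using tB B n by (intro eq_matI) (auto simp: A'_def, metis Suc_less_eq carrier_matD index_transpose_mat(1))
  have "similar_mat B A"
    unfolding similar_mat_def using H A
    by (intro exI[of _ H] similar_mat_witI[of _ _ n]) (auto simp: B_def)
  then have "char_poly A = char_poly B" by (simp add: char_poly_similar)
  also have "\<dots> = char_poly E * char_poly A'"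
    unfolding Bb by (rule char_poly_four_block_zeros_col[OF E _ A']) simp
  also have "char_poly E = [:- e, 1:]"
    by (subst char_poly_upper_triangular[OF E]) (auto simp: E_def diag_mat_def)
  finally have "char_poly A' = (\<Prod>e\<leftarrow>es. [:- e, 1:])"
    using Cons.prems(3) by (simp only: list.map prod_list.Cons mult_cancel_left) simp
  from Cons.IH[OF A' tA' this] obtain U' where U': "U' \<in> carrier_mat m m"
    "transpose_mat U' * U' = 1\<^sub>m m" "A' * U' = U' * mat_diag m ((!) es)" by blast
  define V where "V = four_block_mat (1\<^sub>m 1) (0\<^sub>m 1 m) (0\<^sub>m m 1) U'"
  have V: "V \<in> carrier_mat n n" using U' n by (simp add: V_def four_block_carrier_mat[of _ 1 1 _ m m, simplified])
  have tVV: "transpose_mat V * V = 1\<^sub>m n"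
    unfolding V_def using U' n
    by (subst transpose_four_block_mat[of _ 1 1 _ m _ m]; simp?)
       (subst mult_four_block_mat[of _ 1 1 _ m _ m _ _ 1 _ m]; simp?)
  have D: "mat_diag n ((!) (e # es)) = four_block_mat E (0\<^sub>m 1 m) (0\<^sub>m m 1) (mat_diag m ((!) es))"
    using n by (intro eq_matI) (auto simp: mat_diag_def E_def nth_Cons')
  have BV: "B * V = V * mat_diag n ((!) (e # es))"
    unfolding D Bb V_def using U' A' E
    by (simp add: mult_four_block_mat[of _ 1 1 _ m _ m _ _ 1 _ m] left_mult_zero_mat[OF mat_diag_dim])
  have "A * (H * V) = A * H * V"
    using A H V by simp
  also have "\<dots> = H * (B * V)"
    unfolding HB by (rule assoc_mult_mat[OF H(1) B V])
  also have "\<dots> = (H * V) * mat_diag n ((!) (e # es))"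
    unfolding BV by (rule assoc_mult_mat[symmetric, OF H(1) V mat_diag_dim])
  finally have "A * (H * V) = (H * V) * mat_diag n ((!) (e # es))" .
  moreover have "transpose_mat (H * V) * (H * V) = 1\<^sub>m n"
  proof -
    have "H * (H * V) = V"
      using assoc_mult_mat[OF H(1) H(1) V] H(3) V by simp
    then have "transpose_mat (H * V) * (H * V) = transpose_mat V * V"
      using H V by (simp add: transpose_mult[OF H(1) V] assoc_mult_mat[of _ n n _ n _ n])
    then show ?thesis using tVV by simp
  qed
  ultimately show ?case using H V by (intro bexI[of _ "H * V"]) auto
qed

section \<open>Singular vectors and perturbation of singular values\<close>

lemma vec_l2_eq_L2_set: "vec_l2 v = L2_set (($) v) {0..<dim_vec v}"
  by (simp add: vec_l2_def L2_set_def scalar_prod_def power2_eq_square)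

lemma vec_l2_nonneg [simp]: "0 \<le> vec_l2 v"
  by (simp add: vec_l2_eq_L2_set L2_set_nonneg)

lemma vec_l2_power2: "(vec_l2 v)\<^sup>2 = v \<bullet> v"
  by (simp add: vec_l2_def scalar_prod_def sum_nonneg)

lemma vec_l2_add:
  assumes "u \<in> carrier_vec n" "v \<in> carrier_vec n"
  shows "vec_l2 (u + v) \<le> vec_l2 u + vec_l2 v"
proof -
  have "vec_l2 (u + v) = L2_set (\<lambda>i. u $ i + v $ i) {0..<n}"
    using assms by (auto simp: vec_l2_eq_L2_set intro!: L2_set_cong)
  then show ?thesis
    using assms L2_set_triangle_ineq[of "($) u" "($) v" "{0..<n}"] by (simp add: vec_l2_eq_L2_set)
qed

lemma vec_l2_smult: "vec_l2 (a \<cdot>\<^sub>v v) = \<bar>a\<bar> * vec_l2 v"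
  by (simp add: vec_l2_def real_sqrt_mult mult.assoc[symmetric])

lemma vec_l2_Cauchy_Schwarz:
  assumes "u \<in> carrier_vec n" "v \<in> carrier_vec n"
  shows "\<bar>u \<bullet> v\<bar> \<le> vec_l2 u * vec_l2 v"
proof -
  have "\<bar>u \<bullet> v\<bar> \<le> (\<Sum>i = 0..<n. \<bar>u $ i\<bar> * \<bar>v $ i\<bar>)"
    using assms sum_abs[of "\<lambda>i. u $ i * v $ i" "{0..<n}"] by (simp add: scalar_prod_def abs_mult)
  also have "\<dots> \<le> vec_l2 u * vec_l2 v"
    using assms L2_set_mult_ineq[of "($) u" "($) v" "{0..<n}"] by (simp add: vec_l2_eq_L2_set)
  finally show ?thesis .
qed

text \<open>A crude operator bound. It suffices to make the supremum in \<open>spectral_norm\<close>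
  finite and to show that singular values depend continuously on the entries.\<close>

lemma vec_l2_mult_mat_vec_le_entries:
  assumes A: "A \<in> carrier_mat p n" and x: "x \<in> carrier_vec n"
  shows "vec_l2 (A *\<^sub>v x) \<le> (\<Sum>i<p. \<Sum>j<n. \<bar>A $$ (i, j)\<bar>) * vec_l2 x"
proof -
  have "vec_l2 (A *\<^sub>v x) \<le> (\<Sum>i<p. \<bar>(A *\<^sub>v x) $ i\<bar>)"
    using A by (simp add: vec_l2_eq_L2_set lessThan_atLeast0 L2_set_le_sum_abs del: index_mult_mat_vec)
  also have "\<dots> \<le> (\<Sum>i<p. \<Sum>j<n. \<bar>A $$ (i, j)\<bar> * vec_l2 x)"
  proof (intro sum_mono)
    fix i assume "i \<in> {..<p}"
    then have "\<bar>(A *\<^sub>v x) $ i\<bar> \<le> (\<Sum>j<n. \<bar>A $$ (i, j) * x $ j\<bar>)"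
      using A x by (simp add: scalar_prod_def lessThan_atLeast0)
    also have "\<dots> \<le> (\<Sum>j<n. \<bar>A $$ (i, j)\<bar> * vec_l2 x)"
    proof (intro sum_mono)
      fix j assume "j \<in> {..<n}"
      then have "\<bar>x $ j\<bar> \<le> vec_l2 x"
        using x member_le_L2_set[of "{0..<n}" j "\<lambda>j. \<bar>x $ j\<bar>"]
        by (simp add: vec_l2_eq_L2_set L2_set_def)
      then show "\<bar>A $$ (i, j) * x $ j\<bar> \<le> \<bar>A $$ (i, j)\<bar> * vec_l2 x"
        by (simp add: abs_mult mult_left_mono)
    qed
    finally show "\<bar>(A *\<^sub>v x) $ i\<bar> \<le> (\<Sum>j<n. \<bar>A $$ (i, j)\<bar> * vec_l2 x)" .
  qed
  finally show ?thesis by (simp add: sum_distrib_right)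
qed

lemma scalar_prod_gram:
  fixes A :: "real mat"
  assumes "A \<in> carrier_mat p n" "x \<in> carrier_vec n" "y \<in> carrier_vec n"
  shows "(A *\<^sub>v x) \<bullet> (A *\<^sub>v y) = x \<bullet> (transpose_mat A *\<^sub>v (A *\<^sub>v y))"
  using transpose_vec_mult_scalar[of "transpose_mat A" n p "A *\<^sub>v y" x] assms by simp

section \<open>Extremal properties of the two largest singular values\<close>

lemma proots_linear_factors: "proots (\<Prod>e\<leftarrow>es. [:- e, 1:]) = mset es"
  for es :: "'a :: idom list"
proof (induction es)
  case (Cons e es)
  have "(\<Prod>e\<leftarrow>es. [:- e, 1:]) \<noteq> 0"
    by (auto simp: prod_list_zero_iff)
  then show ?case
    using Cons by (simp add: proots_mult del: mult_pCons_left)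
qed simp

text \<open>The roots are sorted decreasingly before diagonalising, so that column \<open>i\<close>
  of \<open>U\<close> belongs to entry \<open>i\<close> of \<open>singular_values A\<close>.\<close>

lemma singular_values_decomposition:
  assumes A: "A \<in> carrier_mat p n"
  obtains es U where "singular_values A = map sqrt es" "length es = n" "sorted (rev es)"
    "U \<in> carrier_mat n n" "transpose_mat U * U = 1\<^sub>m n"
    "transpose_mat A * A * U = U * mat_diag n ((!) es)"
proof -
  let ?G = "transpose_mat A * A"
  have G: "?G \<in> carrier_mat n n" "transpose_mat ?G = ?G"
    using A by (auto simp: transpose_mult[of _ n p])
  obtain rs where rs: "char_poly ?G = (\<Prod>e\<leftarrow>rs. [:- e, 1:])" "length rs = n"
    using symmetric_char_poly_splits[OF G] by blast
  define es where "es = rev (sort rs)"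
  have es: "length es = n" "sorted (rev es)" "mset es = mset rs"
    using rs by (auto simp: es_def)
  have cp: "char_poly ?G = (\<Prod>e\<leftarrow>es. [:- e, 1:])"
    unfolding rs(1) using es(3) by (metis mset_map prod_mset_prod_list)
  \<comment> \<open>\<open>sqrt\<close> is monotone on all reals, so the order passes to the square
    roots although nonnegativity of the eigenvalues has not been shown yet.\<close>
  have "sorted (rev (map sqrt es))"
    using es(2) by (simp add: rev_map sorted_map)
  then have "sort (map sqrt es) = rev (map sqrt es)"
    by (intro properties_for_sort) auto
  then have "singular_values A = map sqrt es"
    unfolding singular_values_def cp proots_linear_factors
    by (metis mset_map rev_rev_ident sorted_list_of_multiset_mset)
  then show ?thesis
    using symmetric_spectral_decomposition[OF G cp] es that by blast
qed

text \<open>The last clause is the half of the min-max principle that Weyl's inequality needs for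
  the second singular value. Two columns are required for \<open>u1\<close> to exist.\<close>

lemma top_singular_vectors:
  assumes A: "A \<in> carrier_mat p n" and n: "2 \<le> n"
  obtains u0 u1 where "u0 \<in> carrier_vec n" "u1 \<in> carrier_vec n"
    "u0 \<bullet> u0 = 1" "u1 \<bullet> u1 = 1" "u0 \<bullet> u1 = 0"
    "0 \<le> singular_value A 2" "singular_value A 2 \<le> singular_value A 1"
    "transpose_mat A *\<^sub>v (A *\<^sub>v u0) = (singular_value A 1)\<^sup>2 \<cdot>\<^sub>v u0"
    "transpose_mat A *\<^sub>v (A *\<^sub>v u1) = (singular_value A 2)\<^sup>2 \<cdot>\<^sub>v u1"
    "\<And>x. x \<in> carrier_vec n \<Longrightarrow> u0 \<bullet> x = 0 \<Longrightarrow> vec_l2 (A *\<^sub>v x) \<le> singular_value A 2 * vec_l2 x"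
proof -
  let ?G = "transpose_mat A * A"
  obtain es U where es: "singular_values A = map sqrt es" "length es = n" "sorted (rev es)"
    and U: "U \<in> carrier_mat n n" "transpose_mat U * U = 1\<^sub>m n"
    and GU: "?G * U = U * mat_diag n ((!) es)"
    using singular_values_decomposition[OF A] by blast
  have tA: "transpose_mat A \<in> carrier_mat n p" and tU: "transpose_mat U \<in> carrier_mat n n"
    and G: "?G \<in> carrier_mat n n"
    using A U by auto
  have UtU: "U * transpose_mat U = 1\<^sub>m n"
    using mat_mult_left_right_inverse[OF tU U(1)] U(2) by simp
  have orth: "col U i \<bullet> col U j = (if i = j then 1 else 0)" if "i < n" "j < n" for i j
    using arg_cong[OF U(2), of "\<lambda>M. M $$ (i, j)"] that U(1) by simp
  have colU: "col U i \<in> carrier_vec n" for i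
    using U by auto
  have eig: "transpose_mat A *\<^sub>v (A *\<^sub>v col U i) = es ! i \<cdot>\<^sub>v col U i" if i: "i < n" for i
  proof -
    have "?G *\<^sub>v col U i = col (?G * U) i"
      using col_mult2[OF G U(1) i] by simp
    also have "\<dots> = es ! i \<cdot>\<^sub>v col U i"
      unfolding GU mat_diag_mult_right[OF U(1)] using i U by (intro eq_vecI) auto
    finally show ?thesis using tA A colU by simp
  qed
  have nonneg: "0 \<le> es ! i" if i: "i < n" for i
  proof -
    have "es ! i = (vec_l2 (A *\<^sub>v col U i))\<^sup>2"
      unfolding vec_l2_power2 scalar_prod_gram[OF A colU colU] eig[OF i]
      using orth[OF i i] colU by simp
    then show ?thesis by simp
  qed
  have mono: "es ! j \<le> es ! i" if "i \<le> j" "j < n" for i j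
    using sorted_rev_nth_mono[OF es(3)] es(2) that by simp
  have sv: "(singular_value A 1)\<^sup>2 = es ! 0" "(singular_value A 2)\<^sup>2 = es ! 1"
    "0 \<le> singular_value A 2" "singular_value A 2 \<le> singular_value A 1"
    using n es nonneg[of 0] nonneg[of 1] mono[of 0 1] by (auto simp: singular_value_def)
  have "vec_l2 (A *\<^sub>v x) \<le> singular_value A 2 * vec_l2 x"
    if x: "x \<in> carrier_vec n" and ortho: "col U 0 \<bullet> x = 0" for x
  proof -
    \<comment> \<open>Coordinates in the eigenbasis: orthogonality to \<open>col U 0\<close> reads
      \<open>y $ 0 = 0\<close>, so every eigenvalue that contributes to the quadratic form is at
      most \<open>es ! 1\<close>.\<close>
    define y where "y = transpose_mat U *\<^sub>v x"
    have y: "y \<in> carrier_vec n" "U *\<^sub>v y = x"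
      using U tU UtU x by (simp_all add: y_def assoc_mult_mat_vec[symmetric, OF U(1) tU x] del: assoc_mult_mat_vec)
    have yi: "y $ i = col U i \<bullet> x" if "i < n" for i
      using U x that by (simp add: y_def)
    have norm: "x \<bullet> x = y \<bullet> y"
      using transpose_vec_mult_scalar[OF U(1) y(1) x] y by (simp add: y_def)
    have D: "mat_diag n ((!) es) *\<^sub>v y = Matrix.vec n (\<lambda>i. es ! i * y $ i)"
    proof (rule eq_vecI)
      fix i assume "i < dim_vec (Matrix.vec n (\<lambda>i. es ! i * y $ i))"
      then have i: "i < n" by simp
      have "(mat_diag n ((!) es) *\<^sub>v y) $ i = (\<Sum>j = 0..<n. (if i = j then es ! j else 0) * y $ j)"
        using i y by (simp add: mat_diag_def scalar_prod_def)
      also have "\<dots> = (\<Sum>j = 0..<n. if j = i then es ! i * y $ i else 0)"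
        by (rule sum.cong) auto
      finally have "(mat_diag n ((!) es) *\<^sub>v y) $ i = (\<Sum>j = 0..<n. if j = i then es ! i * y $ i else 0)" .
      then show "(mat_diag n ((!) es) *\<^sub>v y) $ i = Matrix.vec n (\<lambda>i. es ! i * y $ i) $ i"
        using i by simp
    qed (simp add: mat_diag_def)
    have "(vec_l2 (A *\<^sub>v x))\<^sup>2 = x \<bullet> (?G *\<^sub>v x)"
      unfolding vec_l2_power2 scalar_prod_gram[OF A x x] using tA A x by simp
    also have "?G *\<^sub>v x = (?G * U) *\<^sub>v y"
      using y(2) assoc_mult_mat_vec[OF G U(1) y(1)] by simp
    also have "\<dots> = U *\<^sub>v (mat_diag n ((!) es) *\<^sub>v y)"
      unfolding GU using U y by (simp add: assoc_mult_mat_vec[of U n n _ n])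
    also have "x \<bullet> \<dots> = y \<bullet> (mat_diag n ((!) es) *\<^sub>v y)"
      unfolding D using transpose_vec_mult_scalar[OF U(1) _ x, of "Matrix.vec n (\<lambda>i. es ! i * y $ i)"]
      by (simp add: y_def)
    also have "\<dots> = (\<Sum>i = 0..<n. es ! i * (y $ i * y $ i))"
      unfolding D by (simp add: scalar_prod_def algebra_simps)
    also have "\<dots> \<le> (\<Sum>i = 0..<n. es ! 1 * (y $ i * y $ i))"
    proof (rule sum_mono)
      fix i assume "i \<in> {0..<n}"
      then show "es ! i * (y $ i * y $ i) \<le> es ! 1 * (y $ i * y $ i)"
        using yi[of 0] ortho n mono[of 1 i] by (cases "i = 0") (auto intro!: mult_right_mono)
    qed
    also have "\<dots> = (singular_value A 2 * vec_l2 x)\<^sup>2"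
      unfolding power_mult_distrib sv vec_l2_power2 norm
      using y by (simp add: scalar_prod_def sum_distrib_left)
    finally show ?thesis
      using sv by (meson mult_nonneg_nonneg power2_le_imp_le vec_l2_nonneg)
  qed
  then show ?thesis
    using that[of "col U 0" "col U 1"] orth n eig[of 0] eig[of 1] colU sv by simp
qed

text \<open>The images under \<open>A\<close> of \<open>u0\<close> and of the component of
  \<open>x\<close> orthogonal to it are again orthogonal, so Pythagoras reduces the bound to the two
  pieces.\<close>

lemma
  assumes A: "A \<in> carrier_mat p n" and n: "2 \<le> n"
  shows singular_value_2_nonneg: "0 \<le> singular_value A 2"
    and vec_l2_mult_le_singular_value_1:
      "x \<in> carrier_vec n \<Longrightarrow> vec_l2 (A *\<^sub>v x) \<le> singular_value A 1 * vec_l2 x"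
proof -
  obtain u0 u1 where u: "u0 \<in> carrier_vec n" "u0 \<bullet> u0 = 1"
    "0 \<le> singular_value A 2" "singular_value A 2 \<le> singular_value A 1"
    "transpose_mat A *\<^sub>v (A *\<^sub>v u0) = (singular_value A 1)\<^sup>2 \<cdot>\<^sub>v u0"
    and rest: "\<And>x. x \<in> carrier_vec n \<Longrightarrow> u0 \<bullet> x = 0 \<Longrightarrow> vec_l2 (A *\<^sub>v x) \<le> singular_value A 2 * vec_l2 x"
    using top_singular_vectors[OF A n] by metis
  then show "0 \<le> singular_value A 2" by auto
  show "vec_l2 (A *\<^sub>v x) \<le> singular_value A 1 * vec_l2 x" if x: "x \<in> carrier_vec n"
  proof -
    define g where "g = u0 \<bullet> x"
    define s where "s = x - g \<cdot>\<^sub>v u0"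
    have s: "s \<in> carrier_vec n" "x = g \<cdot>\<^sub>v u0 + s"
      using x u by (auto simp: s_def)
    have us: "u0 \<bullet> s = 0" "s \<bullet> u0 = 0"
      using u x comm_scalar_prod[OF u(1) s(1)]
      by (auto simp: s_def scalar_prod_minus_distrib[of _ n] g_def)
    have Au: "A *\<^sub>v u0 \<in> carrier_vec p" "A *\<^sub>v s \<in> carrier_vec p" using A u s by auto
    have Ax: "A *\<^sub>v x = g \<cdot>\<^sub>v (A *\<^sub>v u0) + A *\<^sub>v s"
      using A s(1) u by (simp add: s(2) mult_add_distrib_mat_vec[OF A] mult_mat_vec[OF A])
    have cross: "(A *\<^sub>v s) \<bullet> (A *\<^sub>v u0) = 0" "(A *\<^sub>v u0) \<bullet> (A *\<^sub>v s) = 0"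
      "(A *\<^sub>v u0) \<bullet> (A *\<^sub>v u0) = (singular_value A 1)\<^sup>2"
      using scalar_prod_gram[OF A _ u(1)] u us s comm_scalar_prod[OF Au] by auto
    have "(vec_l2 (A *\<^sub>v x))\<^sup>2 = g\<^sup>2 * (singular_value A 1)\<^sup>2 + (vec_l2 (A *\<^sub>v s))\<^sup>2"
      unfolding Ax vec_l2_power2 using Au cross
      by (simp add: scalar_prod_add_distrib[of _ p] add_scalar_prod_distrib[of _ p] power2_eq_square)
    also have "\<dots> \<le> g\<^sup>2 * (singular_value A 1)\<^sup>2 + (singular_value A 1 * vec_l2 s)\<^sup>2"
    proof -
      have "vec_l2 (A *\<^sub>v s) \<le> singular_value A 1 * vec_l2 s"
        using rest[OF s(1) us(1)] u(4) by (meson mult_right_mono order_trans vec_l2_nonneg)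
      then show ?thesis by (simp add: power_mono)
    qed
    also have "\<dots> = (singular_value A 1 * vec_l2 x)\<^sup>2"
    proof -
      have "x \<bullet> x = g\<^sup>2 + s \<bullet> s"
        unfolding s(2) using s(1) u us
        by (simp add: scalar_prod_add_distrib[of _ n] add_scalar_prod_distrib[of _ n] power2_eq_square)
      then show ?thesis by (simp add: power_mult_distrib vec_l2_power2 algebra_simps)
    qed
    finally show ?thesis
      using u by (meson mult_nonneg_nonneg order_trans power2_le_imp_le vec_l2_nonneg)
  qed
qed

section \<open>Perturbation of singular values\<close>

lemma vec_l2_mult_le_perturb:
  assumes AB: "A \<in> carrier_mat p n" "B \<in> carrier_mat p n" and x: "x \<in> carrier_vec n"
    and \<delta>: "vec_l2 ((A - B) *\<^sub>v x) \<le> \<delta> * vec_l2 x"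
  shows "vec_l2 (A *\<^sub>v x) \<le> vec_l2 (B *\<^sub>v x) + \<delta> * vec_l2 x"
proof -
  have "A *\<^sub>v x = B *\<^sub>v x + (A - B) *\<^sub>v x"
    using AB x by (simp add: minus_mult_distrib_mat_vec[of _ p n]) (intro eq_vecI, auto)
  moreover have "B *\<^sub>v x \<in> carrier_vec p" "(A - B) *\<^sub>v x \<in> carrier_vec p"
    using AB by (auto intro!: carrier_vecI)
  ultimately have "vec_l2 (A *\<^sub>v x) \<le> vec_l2 (B *\<^sub>v x) + vec_l2 ((A - B) *\<^sub>v x)"
    using vec_l2_add by metis
  then show ?thesis using \<delta> by simp
qed

text \<open>Weyl's inequality. For the second singular value, a plane of right singular vectors of \<open>A\<close>
  contains a unit vector orthogonal to the first right singular vector of \<open>B\<close>.\<close>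

lemma singular_value_perturb:
  assumes A: "A \<in> carrier_mat p n" and B: "B \<in> carrier_mat p n" and n: "2 \<le> n"
    and \<delta>: "\<And>x. x \<in> carrier_vec n \<Longrightarrow> vec_l2 ((A - B) *\<^sub>v x) \<le> \<delta> * vec_l2 x"
    and k: "k \<in> {1, 2}"
  shows "singular_value A k \<le> singular_value B k + \<delta>"
proof -
  note ABx = vec_l2_mult_le_perturb[OF A B _ \<delta>]
  obtain u0 u1 where u: "u0 \<in> carrier_vec n" "u1 \<in> carrier_vec n"
    "u0 \<bullet> u0 = 1" "u1 \<bullet> u1 = 1" "u0 \<bullet> u1 = 0"
    "0 \<le> singular_value A 2" "singular_value A 2 \<le> singular_value A 1"
    "transpose_mat A *\<^sub>v (A *\<^sub>v u0) = (singular_value A 1)\<^sup>2 \<cdot>\<^sub>v u0"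
    "transpose_mat A *\<^sub>v (A *\<^sub>v u1) = (singular_value A 2)\<^sup>2 \<cdot>\<^sub>v u1"
    using top_singular_vectors[OF A n] by metis
  obtain w where w: "w \<in> carrier_vec n" and
    rest: "\<And>x. x \<in> carrier_vec n \<Longrightarrow> w \<bullet> x = 0 \<Longrightarrow> vec_l2 (B *\<^sub>v x) \<le> singular_value B 2 * vec_l2 x"
    using top_singular_vectors[OF B n] by metis
  have u10: "u1 \<bullet> u0 = 0" using u comm_scalar_prod[OF u(1,2)] by simp
  have Au: "A *\<^sub>v u0 \<in> carrier_vec p" "A *\<^sub>v u1 \<in> carrier_vec p" using A u by auto
  have gram: "(A *\<^sub>v u0) \<bullet> (A *\<^sub>v u0) = (singular_value A 1)\<^sup>2"
    "(A *\<^sub>v u1) \<bullet> (A *\<^sub>v u1) = (singular_value A 2)\<^sup>2"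
    "(A *\<^sub>v u0) \<bullet> (A *\<^sub>v u1) = 0" "(A *\<^sub>v u1) \<bullet> (A *\<^sub>v u0) = 0"
    using scalar_prod_gram[OF A] u u10 by auto
  show ?thesis
  proof (cases "k = 1")
    case True
    have "singular_value A 1 = vec_l2 (A *\<^sub>v u0)"
      using gram(1) u by (simp add: vec_l2_def)
    also have "\<dots> \<le> vec_l2 (B *\<^sub>v u0) + \<delta>"
      using ABx[OF u(1) u(1)] u by (simp add: vec_l2_def)
    also have "\<dots> \<le> singular_value B 1 + \<delta>"
      using vec_l2_mult_le_singular_value_1[OF B n u(1)] u by (simp add: vec_l2_def)
    finally show ?thesis using True by simp
  next
    case False
    obtain a b where ab: "a\<^sup>2 + b\<^sup>2 = 1" "a * (w \<bullet> u0) + b * (w \<bullet> u1) = 0"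
    proof (cases "w \<bullet> u0 = 0")
      case True
      then show ?thesis using that[of 1 0] by simp
    next
      case False
      \<comment> \<open>The pair \<open>(- (w . u1), w . u0)\<close> is orthogonal to
        \<open>(w . u0, w . u1)\<close>; dividing by \<open>sqrt r\<close> makes it a unit
        pair.\<close>
      define r where "r = (w \<bullet> u0)\<^sup>2 + (w \<bullet> u1)\<^sup>2"
      have r: "r > 0" using False by (simp add: r_def sum_power2_gt_zero_iff)
      have "(w \<bullet> u1)\<^sup>2 + (w \<bullet> u0)\<^sup>2 = r" by (simp add: r_def)
      then have "(- (w \<bullet> u1) / sqrt r)\<^sup>2 + ((w \<bullet> u0) / sqrt r)\<^sup>2 = 1"
        using r by (simp add: power_divide add_divide_distrib[symmetric])
      then show ?thesis using that[of "- (w \<bullet> u1) / sqrt r" "(w \<bullet> u0) / sqrt r"] by simp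
    qed
    define x where "x = a \<cdot>\<^sub>v u0 + b \<cdot>\<^sub>v u1"
    have x: "x \<in> carrier_vec n" using u by (simp add: x_def)
    have xx: "vec_l2 x = 1"
      using u u10 ab(1)
      by (simp add: vec_l2_def x_def scalar_prod_add_distrib[of _ n] add_scalar_prod_distrib[of _ n] power2_eq_square)
    have wx: "w \<bullet> x = 0"
      using u w ab(2) by (simp add: x_def scalar_prod_add_distrib[of _ n])
    have Ax: "A *\<^sub>v x = a \<cdot>\<^sub>v (A *\<^sub>v u0) + b \<cdot>\<^sub>v (A *\<^sub>v u1)"
      using u by (simp add: x_def mult_add_distrib_mat_vec[OF A] mult_mat_vec[OF A])
    have "(vec_l2 (A *\<^sub>v x))\<^sup>2 = a\<^sup>2 * (singular_value A 1)\<^sup>2 + b\<^sup>2 * (singular_value A 2)\<^sup>2"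
      unfolding Ax vec_l2_power2 using Au gram
      by (simp add: scalar_prod_add_distrib[of _ p] add_scalar_prod_distrib[of _ p] power2_eq_square)
    also have "\<dots> \<ge> a\<^sup>2 * (singular_value A 2)\<^sup>2 + b\<^sup>2 * (singular_value A 2)\<^sup>2"
      using u by (intro add_mono mult_left_mono power_mono) auto
    also have "a\<^sup>2 * (singular_value A 2)\<^sup>2 + b\<^sup>2 * (singular_value A 2)\<^sup>2 = (singular_value A 2)\<^sup>2"
      using ab(1) by (simp add: distrib_right[symmetric])
    finally have "singular_value A 2 \<le> vec_l2 (A *\<^sub>v x)"
      by (rule power2_le_imp_le) simp
    also have "\<dots> \<le> vec_l2 (B *\<^sub>v x) + \<delta>"
      using ABx[OF x x] xx by simp
    also have "\<dots> \<le> singular_value B 2 + \<delta>"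
      using rest[OF x wx] xx by simp
    finally show ?thesis using False k by simp
  qed
qed

section \<open>Eigenvectors of the symmetric dilation\<close>

lemma symmetric_dilation_mult_vec:
  assumes "A \<in> carrier_mat p n" "a \<in> carrier_vec n" "b \<in> carrier_vec p"
  shows "symmetric_dilation A *\<^sub>v (a @\<^sub>v b) = (transpose_mat A *\<^sub>v b) @\<^sub>v (A *\<^sub>v a)"
proof -
  have "transpose_mat A *\<^sub>v b \<in> carrier_vec n" "A *\<^sub>v a \<in> carrier_vec p"
    using assms by (auto intro!: carrier_vecI)
  moreover have "0\<^sub>m n n *\<^sub>v a = 0\<^sub>v n" "0\<^sub>m p p *\<^sub>v b = 0\<^sub>v p"
    using assms by (auto intro!: eq_vecI)
  ultimately show ?thesis
    using assms unfolding symmetric_dilation_def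
    by (simp add: four_block_mat_mult_vec[of _ n n _ p _ p])
qed

text \<open>Pairing one block equation with the other gives
  \<open>t |a|^2 = (A^T b) . a = b . (A a) = t |b|^2\<close>. So for positive \<open>t\<close> the
  blocks share the norm equally, and this is where the \<open>1 / 2\<close> in the theorem comes
  from.\<close>

lemma symmetric_dilation_eigenvector:
  assumes A: "A \<in> carrier_mat p n" and v: "unit_eigenvector (symmetric_dilation A) v t" and t: "t > 0"
  obtains a b where "v = a @\<^sub>v b" "a \<in> carrier_vec n" "b \<in> carrier_vec p"
    "a \<bullet> a = 1 / 2" "b \<bullet> b = 1 / 2" "transpose_mat A *\<^sub>v b = t \<cdot>\<^sub>v a" "A *\<^sub>v a = t \<cdot>\<^sub>v b"
proof -
  have "dim_row (symmetric_dilation A) = n + p" using A by (simp add: symmetric_dilation_def)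
  then have vc: "v \<in> carrier_vec (n + p)" and eig: "symmetric_dilation A *\<^sub>v v = t \<cdot>\<^sub>v v"
    and norm: "v \<bullet> v = 1"
    using v by (auto simp: unit_eigenvector_def eigenvector_def vec_l2_def)
  define a b where "a = vec_first v n" and "b = vec_last v p"
  have ab: "v = a @\<^sub>v b" "a \<in> carrier_vec n" "b \<in> carrier_vec p"
    using vc by (auto simp: a_def b_def)
  have "(transpose_mat A *\<^sub>v b) @\<^sub>v (A *\<^sub>v a) = (t \<cdot>\<^sub>v a) @\<^sub>v (t \<cdot>\<^sub>v b)"
    using eig unfolding ab(1) symmetric_dilation_mult_vec[OF A ab(2,3)]
    by (auto intro!: eq_vecI)
  then have tA: "transpose_mat A *\<^sub>v b = t \<cdot>\<^sub>v a" and Aa: "A *\<^sub>v a = t \<cdot>\<^sub>v b"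
    using append_vec_eq[of "transpose_mat A *\<^sub>v b" n "t \<cdot>\<^sub>v a"] A ab
    by (auto intro!: carrier_vecI)
  have "t * (a \<bullet> a) = (transpose_mat A *\<^sub>v b) \<bullet> a" using tA ab by simp
  also have "\<dots> = b \<bullet> (A *\<^sub>v a)" by (rule transpose_vec_mult_scalar[OF A ab(2,3)])
  also have "\<dots> = t * (b \<bullet> b)" using Aa ab by simp
  finally have "a \<bullet> a = b \<bullet> b" using t by simp
  moreover have "a \<bullet> a + b \<bullet> b = 1"
    using norm ab(2,3) unfolding ab(1) by (simp add: scalar_prod_append[of _ n _ p])
  ultimately show ?thesis using that ab tA Aa by simp
qed

text \<open>The top eigenvector at hand need not be the one that \<open>top_singular_vectors\<close>
  returns. With a strict gap the two are proportional: the part \<open>s\<close> of \<open>e\<close>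
  orthogonal to \<open>u\<close> is stretched by exactly the first singular value but by at most the
  second, so it vanishes.\<close>

lemma top_right_singular_vector_gap:
  assumes A: "A \<in> carrier_mat p n" and n: "2 \<le> n"
    and gap: "singular_value A 2 < singular_value A 1"
    and e: "e \<in> carrier_vec n" "transpose_mat A *\<^sub>v (A *\<^sub>v e) = (singular_value A 1)\<^sup>2 \<cdot>\<^sub>v e" "e \<noteq> 0\<^sub>v n"
    and x: "x \<in> carrier_vec n" "e \<bullet> x = 0"
  shows "vec_l2 (A *\<^sub>v x) \<le> singular_value A 2 * vec_l2 x"
proof -
  obtain u where u: "u \<in> carrier_vec n" "u \<bullet> u = 1"
    "0 \<le> singular_value A 2"
    "transpose_mat A *\<^sub>v (A *\<^sub>v u) = (singular_value A 1)\<^sup>2 \<cdot>\<^sub>v u"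
    and rest: "\<And>x. x \<in> carrier_vec n \<Longrightarrow> u \<bullet> x = 0 \<Longrightarrow> vec_l2 (A *\<^sub>v x) \<le> singular_value A 2 * vec_l2 x"
    using top_singular_vectors[OF A n] by metis
  define s where "s = e - (u \<bullet> e) \<cdot>\<^sub>v u"
  have s: "s \<in> carrier_vec n" "e = (u \<bullet> e) \<cdot>\<^sub>v u + s" "u \<bullet> s = 0"
    using e u by (auto simp: s_def scalar_prod_minus_distrib[of _ n])
  have Ae: "A *\<^sub>v e \<in> carrier_vec p" and Au: "A *\<^sub>v u \<in> carrier_vec p"
    using A e u by auto
  have tA: "transpose_mat A \<in> carrier_mat n p" using A by simp
  have "A *\<^sub>v s = A *\<^sub>v e - (u \<bullet> e) \<cdot>\<^sub>v (A *\<^sub>v u)"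
    using e u by (simp add: s_def mult_minus_distrib_mat_vec[OF A] mult_mat_vec[OF A])
  then have "transpose_mat A *\<^sub>v (A *\<^sub>v s) = (singular_value A 1)\<^sup>2 \<cdot>\<^sub>v e - (u \<bullet> e) \<cdot>\<^sub>v ((singular_value A 1)\<^sup>2 \<cdot>\<^sub>v u)"
    using Ae Au e u by (simp add: mult_minus_distrib_mat_vec[OF tA] mult_mat_vec[OF tA])
  also have "\<dots> = (singular_value A 1)\<^sup>2 \<cdot>\<^sub>v s"
    using e u unfolding s_def by (intro eq_vecI) (auto simp: algebra_simps)
  finally have "(vec_l2 (A *\<^sub>v s))\<^sup>2 = (singular_value A 1 * vec_l2 s)\<^sup>2"
    unfolding power_mult_distrib vec_l2_power2 scalar_prod_gram[OF A s(1) s(1)] using s(1) by simp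
  moreover have "(vec_l2 (A *\<^sub>v s))\<^sup>2 \<le> (singular_value A 2 * vec_l2 s)\<^sup>2"
    using rest[OF s(1,3)] by (simp add: power_mono)
  ultimately have "(singular_value A 1)\<^sup>2 * (vec_l2 s)\<^sup>2 \<le> (singular_value A 2)\<^sup>2 * (vec_l2 s)\<^sup>2"
    by (simp add: power_mult_distrib)
  moreover have "(singular_value A 2)\<^sup>2 < (singular_value A 1)\<^sup>2"
    using gap u(3) by (simp add: power_strict_mono)
  ultimately have "(vec_l2 s)\<^sup>2 = 0"
    by (metis linorder_not_le mult_le_cancel_right zero_less_power2 zero_le_power2 order_antisym_conv)
  then have "s = 0\<^sub>v n"
    using conjugate_square_eq_0_vec[OF s(1)] by (simp add: vec_l2_power2)
  then have eu: "e = (u \<bullet> e) \<cdot>\<^sub>v u" using s(2) u by simp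
  then have "u \<bullet> e \<noteq> 0" using e(3) u(1) by auto
  moreover have "(u \<bullet> e) * (u \<bullet> x) = 0" using x u eu by (metis smult_scalar_prod_distrib)
  ultimately show ?thesis using rest[OF x(1)] by simp
qed

text \<open>A Davis--Kahan bound for the right singular vectors: with \<open>x = \<alpha> e + r\<close>, \<open>r\<close> orthogonal to \<open>e\<close>,
  the energy \<open>|A x|\<^sup>2 = \<alpha>\<^sup>2 d1\<^sup>2 + |A r|\<^sup>2\<close> is nearly the maximal \<open>d1\<^sup>2 |x|\<^sup>2\<close> only if \<open>r\<close> is small.\<close>

lemma top_right_singular_vector_perturb:
  assumes A: "A \<in> carrier_mat p n" and X: "X \<in> carrier_mat p n" and n: "2 \<le> n"
    and \<delta>: "\<And>x. x \<in> carrier_vec n \<Longrightarrow> vec_l2 ((A - X) *\<^sub>v x) \<le> \<delta> * vec_l2 x"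
    and \<delta>': "\<And>x. x \<in> carrier_vec n \<Longrightarrow> vec_l2 ((X - A) *\<^sub>v x) \<le> \<delta> * vec_l2 x"
    and gap: "singular_value A 2 < singular_value A 1" and small: "2 * \<delta> \<le> singular_value A 1"
    and e: "e \<in> carrier_vec n" "transpose_mat A *\<^sub>v (A *\<^sub>v e) = (singular_value A 1)\<^sup>2 \<cdot>\<^sub>v e" "e \<bullet> e = 1"
    and x: "x \<in> carrier_vec n" "vec_l2 (X *\<^sub>v x) = singular_value X 1 * vec_l2 x"
  shows "((singular_value A 1)\<^sup>2 - (singular_value A 2)\<^sup>2) * ((vec_l2 x)\<^sup>2 - (e \<bullet> x)\<^sup>2)
    \<le> 4 * \<delta> * singular_value A 1 * (vec_l2 x)\<^sup>2"
proof -
  let ?d1 = "singular_value A 1" and ?d2 = "singular_value A 2"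
  define s where "s = x - (e \<bullet> x) \<cdot>\<^sub>v e"
  have s: "s \<in> carrier_vec n" "x = (e \<bullet> x) \<cdot>\<^sub>v e + s" "e \<bullet> s = 0"
    using e x by (auto simp: s_def scalar_prod_minus_distrib[of _ n])
  have se: "s \<bullet> e = 0" using s e comm_scalar_prod by metis
  have e0: "e \<noteq> 0\<^sub>v n" using e by auto
  have Ae: "A *\<^sub>v e \<in> carrier_vec p" and As: "A *\<^sub>v s \<in> carrier_vec p"
    using A e s by auto
  have xx: "(vec_l2 x)\<^sup>2 = (e \<bullet> x)\<^sup>2 + (vec_l2 s)\<^sup>2"
  proof -
    have "((e \<bullet> x) \<cdot>\<^sub>v e + s) \<bullet> ((e \<bullet> x) \<cdot>\<^sub>v e + s) = (e \<bullet> x)\<^sup>2 + s \<bullet> s"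
      using s(1,3) e se
      by (simp add: scalar_prod_add_distrib[of _ n] add_scalar_prod_distrib[of _ n] power2_eq_square)
    then show ?thesis unfolding vec_l2_power2 s(2)[symmetric] .
  qed
  have cross: "(A *\<^sub>v s) \<bullet> (A *\<^sub>v e) = 0" "(A *\<^sub>v e) \<bullet> (A *\<^sub>v s) = 0" "(A *\<^sub>v e) \<bullet> (A *\<^sub>v e) = ?d1\<^sup>2"
    using scalar_prod_gram[OF A _ e(1)] e s se comm_scalar_prod[OF Ae As] by auto
  have "A *\<^sub>v x = (e \<bullet> x) \<cdot>\<^sub>v (A *\<^sub>v e) + A *\<^sub>v s"
  proof -
    have "A *\<^sub>v ((e \<bullet> x) \<cdot>\<^sub>v e + s) = (e \<bullet> x) \<cdot>\<^sub>v (A *\<^sub>v e) + A *\<^sub>v s"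
      using e(1) s(1) by (simp add: mult_add_distrib_mat_vec[OF A] mult_mat_vec[OF A])
    then show ?thesis unfolding s(2)[symmetric] .
  qed
  then have "(vec_l2 (A *\<^sub>v x))\<^sup>2 = (e \<bullet> x)\<^sup>2 * ?d1\<^sup>2 + (vec_l2 (A *\<^sub>v s))\<^sup>2"
    unfolding vec_l2_power2 using Ae As cross
    by (simp add: scalar_prod_add_distrib[of _ p] add_scalar_prod_distrib[of _ p] power2_eq_square)
  also have "\<dots> \<le> (e \<bullet> x)\<^sup>2 * ?d1\<^sup>2 + ?d2\<^sup>2 * (vec_l2 s)\<^sup>2"
    using top_right_singular_vector_gap[OF A n gap e(1,2) e0 s(1,3)]
    by (simp add: power_mono flip: power_mult_distrib)
  finally have upper: "(vec_l2 (A *\<^sub>v x))\<^sup>2 \<le> (e \<bullet> x)\<^sup>2 * ?d1\<^sup>2 + ?d2\<^sup>2 * ((vec_l2 x)\<^sup>2 - (e \<bullet> x)\<^sup>2)"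
    using xx by simp
  \<comment> \<open>\<open>x\<close> is extremal for \<open>X\<close>, not for \<open>A\<close>. The
    transfer costs \<delta> twice: once in Weyl's inequality, and once in comparing
    \<open>|X x|\<close> with \<open>|A x|\<close>. The hypothesis \<open>small\<close> then permits
    squaring \<open>?d1 - 2 * \<delta>\<close>, and the square is bounded below by dropping its term
    in \<open>\<delta>\<^sup>2\<close>.\<close>
  have "?d1 - \<delta> \<le> singular_value X 1"
    using singular_value_perturb[OF A X n \<delta>, of 1] by simp
  then have "(?d1 - \<delta>) * vec_l2 x \<le> vec_l2 (A *\<^sub>v x) + \<delta> * vec_l2 x"
    using vec_l2_mult_le_perturb[OF X A x(1) \<delta>'[OF x(1)]] x(2)
    by (smt (verit) mult_right_mono vec_l2_nonneg)
  then have "(?d1 - 2 * \<delta>) * vec_l2 x \<le> vec_l2 (A *\<^sub>v x)"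
    by (simp add: algebra_simps)
  then have "((?d1 - 2 * \<delta>) * vec_l2 x)\<^sup>2 \<le> (vec_l2 (A *\<^sub>v x))\<^sup>2"
    using small by (intro power_mono) auto
  moreover have "((?d1 - 2 * \<delta>) * vec_l2 x)\<^sup>2 \<ge> (?d1\<^sup>2 - 4 * \<delta> * ?d1) * (vec_l2 x)\<^sup>2"
    unfolding power_mult_distrib by (intro mult_right_mono) (auto simp: power2_eq_square algebra_simps)
  ultimately have "(?d1\<^sup>2 - 4 * \<delta> * ?d1) * (vec_l2 x)\<^sup>2
      \<le> (e \<bullet> x)\<^sup>2 * ?d1\<^sup>2 + ?d2\<^sup>2 * ((vec_l2 x)\<^sup>2 - (e \<bullet> x)\<^sup>2)"
    using upper by linarith
  then show ?thesis by (simp add: algebra_simps)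
qed

section \<open>The spectral norm and a lattice net\<close>

text \<open>The supremum over reals is informative only for a set that is bounded above, and the sum
  of the absolute entries is such a bound. Arbitrary \<open>x\<close> follow by scaling to the unit
  sphere.\<close>

lemma
  assumes A: "A \<in> carrier_mat p n"
  shows vec_l2_mult_le_spectral_norm: "x \<in> carrier_vec n \<Longrightarrow> vec_l2 (A *\<^sub>v x) \<le> spectral_norm A * vec_l2 x"
    and spectral_norm_le: "(\<And>x. x \<in> carrier_vec n \<Longrightarrow> vec_l2 x \<le> 1 \<Longrightarrow> vec_l2 (A *\<^sub>v x) \<le> c) \<Longrightarrow> spectral_norm A \<le> c"
    and spectral_norm_nonneg: "0 \<le> spectral_norm A"
proof -
  let ?B = "{x \<in> carrier_vec n. vec_l2 x \<le> 1}"
  have zero: "0\<^sub>v n \<in> ?B" by (simp add: vec_l2_def)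
  have def: "spectral_norm A = (SUP x\<in>?B. vec_l2 (A *\<^sub>v x))"
    using A by (simp add: spectral_norm_def)
  have bdd: "bdd_above ((\<lambda>x. vec_l2 (A *\<^sub>v x)) ` ?B)"
  proof (rule bdd_aboveI2)
    fix x assume x: "x \<in> ?B"
    have "vec_l2 (A *\<^sub>v x) \<le> (\<Sum>i<p. \<Sum>j<n. \<bar>A $$ (i, j)\<bar>) * vec_l2 x"
      using vec_l2_mult_mat_vec_le_entries[OF A] x by simp
    also have "\<dots> \<le> (\<Sum>i<p. \<Sum>j<n. \<bar>A $$ (i, j)\<bar>) * 1"
      using x by (intro mult_left_mono) (auto intro!: sum_nonneg)
    finally show "vec_l2 (A *\<^sub>v x) \<le> (\<Sum>i<p. \<Sum>j<n. \<bar>A $$ (i, j)\<bar>)" by simp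
  qed
  have upper: "vec_l2 (A *\<^sub>v x) \<le> spectral_norm A" if "x \<in> ?B" for x
    unfolding def by (rule cSUP_upper[OF that bdd])
  show "0 \<le> spectral_norm A" using upper[OF zero] vec_l2_nonneg by (rule order_trans[rotated])
  show "spectral_norm A \<le> c" if "\<And>x. x \<in> carrier_vec n \<Longrightarrow> vec_l2 x \<le> 1 \<Longrightarrow> vec_l2 (A *\<^sub>v x) \<le> c"
    unfolding def using zero that by (intro cSUP_least) blast+
  show "vec_l2 (A *\<^sub>v x) \<le> spectral_norm A * vec_l2 x" if x: "x \<in> carrier_vec n"
  proof (cases "vec_l2 x = 0")
    case True
    then have "x = 0\<^sub>v n"
      using conjugate_square_eq_0_vec[OF x] vec_l2_power2[of x] by simp
    then have "A *\<^sub>v x = 0\<^sub>v p" using A by (auto intro!: eq_vecI)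
    then show ?thesis using True by (simp add: vec_l2_def)
  next
    case False
    then have pos: "vec_l2 x > 0" using vec_l2_nonneg[of x] by linarith
    have "vec_l2 (A *\<^sub>v ((1 / vec_l2 x) \<cdot>\<^sub>v x)) \<le> spectral_norm A"
      using pos x by (intro upper) (simp add: vec_l2_smult)
    then show ?thesis
      using pos by (simp add: mult_mat_vec[OF A x] vec_l2_smult field_simps)
  qed
qed

text \<open>The points \<open>k / (4 \<surd>N)\<close>, \<open>k\<close> an integer vector, of norm at most \<open>5/4\<close>. By Cauchy--Schwarz
  such \<open>k\<close> have \<open>\<ell>\<^sub>1\<close>-norm at most \<open>5N\<close>, which makes them easy to count.\<close>

definition lattice_net :: "nat \<Rightarrow> real vec set" where
  "lattice_net N = {v \<in> (\<lambda>k. Matrix.vec N (\<lambda>i. real_of_int (k i) / (4 * sqrt N))) `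
     {k \<in> {..<N} \<rightarrow>\<^sub>E {-5 * int N..5 * int N}. (\<Sum>i<N. \<bar>k i\<bar>) \<le> 5 * int N}. vec_l2 v \<le> 5 / 4}"

lemma lattice_net_carrier: "v \<in> lattice_net N \<Longrightarrow> v \<in> carrier_vec N"
  unfolding lattice_net_def by clarsimp

lemma lattice_net_norm: "v \<in> lattice_net N \<Longrightarrow> vec_l2 v \<le> 5 / 4"
  by (simp add: lattice_net_def)

lemma finite_lattice_net: "finite (lattice_net N)"
proof -
  have "finite ({..<N} \<rightarrow>\<^sub>E {-5 * int N..5 * int N})" by (rule finite_PiE) simp_all
  then show ?thesis by (simp add: lattice_net_def)
qed

lemma sum_geometric_two_sided: "(\<Sum>j\<in>{- int m..int m}. (1 / 2 :: real) ^ nat \<bar>j\<bar>) \<le> 3"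
proof -
  have "(\<Sum>j\<in>{- int m..int m}. (1 / 2 :: real) ^ nat \<bar>j\<bar>) = 3 - 2 * (1 / 2) ^ m"
  proof (induction m)
    case (Suc m)
    have "{- int (Suc m)..int (Suc m)} = insert (int (Suc m)) (insert (- int (Suc m)) {- int m..int m})"
      by auto
    then have "(\<Sum>j\<in>{- int (Suc m)..int (Suc m)}. (1 / 2 :: real) ^ nat \<bar>j\<bar>)
      = 2 * (1 / 2) ^ Suc m + (\<Sum>j\<in>{- int m..int m}. (1 / 2 :: real) ^ nat \<bar>j\<bar>)"
      by (simp add: nat_add_distrib)
    then show ?case using Suc by simp
  qed simp
  then show ?thesis by simp
qed

text \<open>Weighting \<open>k\<close> by \<open>2\<close> to the power \<open>-|k|\<^sub>1\<close> turns the count into a product of geometric sums.\<close>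

lemma card_lattice_net: "real (card (lattice_net N)) \<le> 96 ^ N"
proof -
  let ?P = "{..<N} \<rightarrow>\<^sub>E {-5 * int N..5 * int N}"
  let ?K = "{k \<in> ?P. (\<Sum>i<N. \<bar>k i\<bar>) \<le> 5 * int N}"
  have finP: "finite ?P" by (rule finite_PiE) simp_all
  then have fin: "finite ?K" by simp
  have "card (lattice_net N) \<le> card ?K"
    unfolding lattice_net_def
    by (rule order_trans[OF card_mono[OF finite_imageI[OF fin] Collect_restrict] card_image_le[OF fin]])
  then have "real (card (lattice_net N)) \<le> (\<Sum>k\<in>?K. 1)" by simp
  also have "\<dots> \<le> (\<Sum>k\<in>?K. 32 ^ N * (\<Prod>i<N. (1 / 2) ^ nat \<bar>k i\<bar>))"
  proof (rule sum_mono)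
    fix k assume k: "k \<in> ?K"
    have "int (\<Sum>i<N. nat \<bar>k i\<bar>) = (\<Sum>i<N. \<bar>k i\<bar>)" by simp
    also have "\<dots> \<le> int (5 * N)" using k by simp
    finally have le: "(\<Sum>i<N. nat \<bar>k i\<bar>) \<le> 5 * N" by (simp only: of_nat_le_iff)
    \<comment> \<open>The factor \<open>32 ^ N = 2 ^ (5 N)\<close> compensates the smallest weight
      that a counted \<open>k\<close> can have; the final \<open>96\<close> is \<open>32\<close>
      times the bound \<open>3\<close> on the geometric sum.\<close>
    have "(1::real) = (32 * (1 / 2) ^ 5) ^ N" by (simp add: power_divide)
    also have "\<dots> = 32 ^ N * (1 / 2) ^ (5 * N)"
      by (simp only: power_mult_distrib power_mult)
    also have "\<dots> \<le> 32 ^ N * (1 / 2) ^ (\<Sum>i<N. nat \<bar>k i\<bar>)"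
      by (intro mult_left_mono power_decreasing le) auto
    finally show "(1::real) \<le> 32 ^ N * (\<Prod>i<N. (1 / 2) ^ nat \<bar>k i\<bar>)"
      by (simp add: power_sum)
  qed
  also have "\<dots> \<le> (\<Sum>k\<in>?P. 32 ^ N * (\<Prod>i<N. (1 / 2) ^ nat \<bar>k i\<bar>))"
    by (rule sum_mono2[OF finP Collect_restrict]) (intro mult_nonneg_nonneg prod_nonneg, simp_all)
  also have "\<dots> = 32 ^ N * (\<Prod>i<N. \<Sum>j\<in>{-5 * int N..5 * int N}. (1 / 2) ^ nat \<bar>j\<bar>)"
    unfolding sum_distrib_left[symmetric] by (subst prod_sum_PiE) simp_all
  also have "\<dots> \<le> 32 ^ N * (\<Prod>i<N. 3)"
    using sum_geometric_two_sided[of "5 * N"]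
    by (intro mult_left_mono prod_mono conjI sum_nonneg) simp_all
  also have "\<dots> = (32 * 3) ^ N" by (simp only: power_mult_distrib prod_constant card_lessThan)
  also have "\<dots> = 96 ^ N" by simp
  finally show ?thesis .
qed

text \<open>Round every coordinate down to the lattice of spacing \<open>r\<close>. The error is at
  most \<open>r\<close> per coordinate, hence \<open>r sqrt N = 1/4\<close> in norm, which also
  gives the norm bound \<open>5/4\<close>. The integer vector has \<open>l1\<close>-norm at most
  \<open>|x|_1 / r + N\<close>, and Cauchy-Schwarz bounds the first term by
  \<open>4 N\<close>.\<close>

lemma lattice_net_approx:
  assumes x: "x \<in> carrier_vec N" "vec_l2 x \<le> 1" and N: "N > 0"
  obtains v where "v \<in> lattice_net N" "vec_l2 (x - v) \<le> 1 / 4"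
proof -
  define r where "r = 1 / (4 * sqrt N)"
  have r: "r > 0" using N by (simp add: r_def)
  have rN: "r * sqrt N = 1 / 4" "r\<^sup>2 * N = 1 / 16" using N by (auto simp: r_def power_divide power_mult_distrib)
  define k where "k = (\<lambda>i\<in>{..<N}. \<lfloor>x $ i / r\<rfloor>)"
  define v where "v = Matrix.vec N (\<lambda>i. real_of_int (k i) / (4 * sqrt N))"
  have v: "v \<in> carrier_vec N" by (simp add: v_def)
  have vi: "v $ i = real_of_int \<lfloor>x $ i / r\<rfloor> * r" if "i < N" for i
    using that by (simp add: v_def k_def r_def)
  have diff: "\<bar>x $ i - v $ i\<bar> \<le> r" if i: "i < N" for i
  proof -
    have "real_of_int \<lfloor>x $ i / r\<rfloor> * r \<le> x $ i / r * r" "x $ i / r * r \<le> (real_of_int \<lfloor>x $ i / r\<rfloor> + 1) * r"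
      using r by (intro mult_right_mono; linarith)+
    then have "real_of_int \<lfloor>x $ i / r\<rfloor> * r \<le> x $ i" "x $ i \<le> (real_of_int \<lfloor>x $ i / r\<rfloor> + 1) * r"
      using r by simp_all
    then show ?thesis unfolding vi[OF i] by (simp add: algebra_simps)
  qed
  have "(vec_l2 (x - v))\<^sup>2 = (\<Sum>i = 0..<N. \<bar>x $ i - v $ i\<bar>\<^sup>2)"
    unfolding vec_l2_power2 using x v by (simp add: scalar_prod_def power2_eq_square)
  also have "\<dots> \<le> (\<Sum>i = 0..<N. r\<^sup>2)"
    using diff by (intro sum_mono power_mono) auto
  also have "\<dots> = (1 / 4)\<^sup>2" using rN by (simp add: mult.commute power2_eq_square)
  finally have dist: "vec_l2 (x - v) \<le> 1 / 4"
    by (rule power2_le_imp_le) simp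
  have "v = x + (-1) \<cdot>\<^sub>v (x - v)" using x v by (intro eq_vecI) auto
  then have "vec_l2 v \<le> vec_l2 x + vec_l2 ((-1) \<cdot>\<^sub>v (x - v))"
    using x v by (metis vec_l2_add minus_carrier_vec smult_carrier_vec)
  then have norm: "vec_l2 v \<le> 5 / 4" using dist x(2) by (simp add: vec_l2_smult)
  have "(\<Sum>i<N. \<bar>x $ i\<bar>) \<le> sqrt N * vec_l2 x"
    using L2_set_mult_ineq[of "\<lambda>_. 1" "($) x" "{0..<N}"] x
    by (simp add: vec_l2_eq_L2_set lessThan_atLeast0 L2_set_def[of "\<lambda>_. 1"])
  also have "\<dots> \<le> sqrt N" using x(2) mult_left_mono[of "vec_l2 x" 1 "sqrt N"] by simp
  finally have "(\<Sum>i<N. \<bar>x $ i\<bar>) * (4 * sqrt N) \<le> sqrt N * (4 * sqrt N)"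
    by (intro mult_right_mono) auto
  then have l1: "(\<Sum>i<N. \<bar>x $ i\<bar>) / r \<le> 4 * real N"
    by (simp add: r_def)
  have "real_of_int (\<Sum>i<N. \<bar>k i\<bar>) \<le> (\<Sum>i<N. \<bar>x $ i\<bar> / r + 1)"
    unfolding of_int_sum
  proof (rule sum_mono)
    fix i assume "i \<in> {..<N}"
    moreover have "real_of_int \<bar>\<lfloor>x $ i / r\<rfloor>\<bar> \<le> \<bar>x $ i / r\<bar> + 1"
      by linarith
    ultimately have "real_of_int \<bar>k i\<bar> \<le> \<bar>x $ i / r\<bar> + 1"
      by (simp add: k_def)
    then show "real_of_int \<bar>k i\<bar> \<le> \<bar>x $ i\<bar> / r + 1" using r by simp
  qed
  also have "\<dots> \<le> 5 * real N"
    using l1 by (simp add: sum.distrib sum_divide_distrib)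
  finally have sum_k: "(\<Sum>i<N. \<bar>k i\<bar>) \<le> 5 * int N" by linarith
  have "k \<in> {..<N} \<rightarrow>\<^sub>E {-5 * int N..5 * int N}"
  proof (rule PiE_I)
    fix i assume i: "i \<in> {..<N}"
    have "\<bar>k i\<bar> \<le> (\<Sum>i<N. \<bar>k i\<bar>)" by (rule member_le_sum[OF i]) simp_all
    then show "k i \<in> {-5 * int N..5 * int N}" using sum_k by (simp add: abs_le_iff)
  qed (simp add: k_def)
  then have "v \<in> lattice_net N"
    unfolding lattice_net_def v_def[symmetric] using sum_k norm
    by (intro CollectI conjI image_eqI[of _ _ k]) (simp_all add: v_def)
  then show ?thesis using that dist by blast
qed

text \<open>Take \<open>y\<close> in the direction of \<open>W z\<close> and replace both vectors by
  net points at distance at most \<open>1/4\<close>. Replacing \<open>y\<close> costs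
  \<open>B / 4\<close>; replacing \<open>z\<close> costs \<open>(5/4) (B / 4)\<close>, since net
  points have norm up to \<open>5/4\<close>. The total \<open>9/16 B\<close> is absorbed on the
  left, leaving the factor \<open>16/7\<close>, rounded up to 4.\<close>

lemma operator_bound_from_net:
  assumes W: "W \<in> carrier_mat p n" and dims: "0 < p" "0 < n" and s: "0 \<le> s"
    and net: "\<And>x y. x \<in> lattice_net n \<Longrightarrow> y \<in> lattice_net p \<Longrightarrow> y \<bullet> (W *\<^sub>v x) \<le> s"
    and x: "x \<in> carrier_vec n"
  shows "vec_l2 (W *\<^sub>v x) \<le> 4 * s * vec_l2 x"
proof -
  let ?B = "spectral_norm W"
  note bound = vec_l2_mult_le_spectral_norm[OF W]
  have B: "0 \<le> ?B" by (rule spectral_norm_nonneg[OF W])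
  have "?B \<le> s + 9 / 16 * ?B"
  proof (rule spectral_norm_le[OF W])
    fix z :: "real vec" assume z: "z \<in> carrier_vec n" "vec_l2 z \<le> 1"
    have Wz: "W *\<^sub>v z \<in> carrier_vec p" using W z by simp
    show "vec_l2 (W *\<^sub>v z) \<le> s + 9 / 16 * ?B"
    proof (cases "vec_l2 (W *\<^sub>v z) = 0")
      case True
      then show ?thesis using s B by simp
    next
      case False
      define y where "y = (1 / vec_l2 (W *\<^sub>v z)) \<cdot>\<^sub>v (W *\<^sub>v z)"
      have y: "y \<in> carrier_vec p" "vec_l2 y = 1" "y \<bullet> (W *\<^sub>v z) = vec_l2 (W *\<^sub>v z)"
        using Wz False by (auto simp: y_def vec_l2_smult vec_l2_power2[symmetric] power2_eq_square)
      obtain z' where z': "z' \<in> lattice_net n" "vec_l2 (z - z') \<le> 1 / 4"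
        using lattice_net_approx[OF z dims(2)] .
      obtain y' where y': "y' \<in> lattice_net p" "vec_l2 (y - y') \<le> 1 / 4"
        using lattice_net_approx[OF y(1) _ dims(1)] y(2) by auto
      note carr = lattice_net_carrier[OF z'(1)] lattice_net_carrier[OF y'(1)]
      have Wz': "W *\<^sub>v z' \<in> carrier_vec p" "W *\<^sub>v (z - z') \<in> carrier_vec p"
        using W carr z by auto
      have "vec_l2 (W *\<^sub>v z) = y' \<bullet> (W *\<^sub>v z') + (y - y') \<bullet> (W *\<^sub>v z) + y' \<bullet> (W *\<^sub>v (z - z'))"
        unfolding y(3)[symmetric] using Wz Wz' carr y(1) z(1)
        by (simp add: mult_minus_distrib_mat_vec[OF W] scalar_prod_minus_distrib[of _ p]
            minus_scalar_prod_distrib[of _ p])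
      moreover have "(y - y') \<bullet> (W *\<^sub>v z) \<le> 1 / 4 * ?B"
      proof -
        have "(y - y') \<bullet> (W *\<^sub>v z) \<le> vec_l2 (y - y') * vec_l2 (W *\<^sub>v z)"
          using vec_l2_Cauchy_Schwarz[of "y - y'" p "W *\<^sub>v z"] Wz y carr by auto
        also have "\<dots> \<le> 1 / 4 * ?B"
          using y'(2) bound[OF z(1)] z(2) B mult_left_mono[of "vec_l2 z" 1 ?B]
          by (intro mult_mono) auto
        finally show ?thesis .
      qed
      moreover have "y' \<bullet> (W *\<^sub>v (z - z')) \<le> 5 / 4 * (?B * (1 / 4))"
      proof -
        have "y' \<bullet> (W *\<^sub>v (z - z')) \<le> vec_l2 y' * vec_l2 (W *\<^sub>v (z - z'))"
          using vec_l2_Cauchy_Schwarz[of y' p "W *\<^sub>v (z - z')"] Wz' carr by auto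
        also have "\<dots> \<le> 5 / 4 * (?B * (1 / 4))"
        proof (rule mult_mono)
          show "vec_l2 (W *\<^sub>v (z - z')) \<le> ?B * (1 / 4)"
            using bound[of "z - z'"] z(1) carr z'(2) B
            by (meson minus_carrier_vec mult_left_mono order_trans)
        qed (use lattice_net_norm[OF y'(1)] in auto)
        finally show ?thesis .
      qed
      ultimately show ?thesis using net[OF z'(1) y'(1)] by linarith
    qed
  qed
  then have "?B \<le> 4 * s" using s by linarith
  then show ?thesis
    using bound[OF x] by (meson mult_right_mono order_trans vec_l2_nonneg)
qed

section \<open>The operator norm of Gaussian noise\<close>

text \<open>Completing the square turns the tilted density into the normal density of mean
  \<open>t * v\<close>. The point mass at \<open>v = 0\<close> obeys the same formula, so singular
  covariances are covered. The nonnegative integral spares integrability side conditions.\<close>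

lemma nn_integral_exp_normal_law:
  assumes v: "0 \<le> v"
  shows "(\<integral>\<^sup>+z. ennreal (exp (t * z)) \<partial>normal_law 0 v) = ennreal (exp (t\<^sup>2 * v / 2))"
proof (cases "v = 0")
  case True
  then show ?thesis by (simp add: normal_law_def nn_integral_return)
next
  case False
  then have sv: "0 < sqrt v" "v > 0" using v by auto
  have shift: "normal_density 0 (sqrt v) z * exp (t * z) = exp (t\<^sup>2 * v / 2) * normal_density (t * v) (sqrt v) z" for z
  proof -
    have "- z\<^sup>2 / (2 * v) + t * z = t\<^sup>2 * v / 2 - (z - t * v)\<^sup>2 / (2 * v)"
      using sv by (simp add: field_simps power2_eq_square)
    then have "exp (- z\<^sup>2 / (2 * v)) * exp (t * z) = exp (t\<^sup>2 * v / 2) * exp (- (z - t * v)\<^sup>2 / (2 * v))"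
      by (simp flip: exp_add)
    then show ?thesis using sv by (simp add: normal_density_def)
  qed
  have "(\<integral>\<^sup>+z. ennreal (exp (t * z)) \<partial>normal_law 0 v)
    = (\<integral>\<^sup>+z. ennreal (normal_density 0 (sqrt v) z) * ennreal (exp (t * z)) \<partial>lborel)"
    using False by (simp add: normal_law_def nn_integral_density)
  also have "\<dots> = (\<integral>\<^sup>+z. ennreal (exp (t\<^sup>2 * v / 2)) * ennreal (normal_density (t * v) (sqrt v) z) \<partial>lborel)"
    by (simp add: shift flip: ennreal_mult)
  also have "\<dots> = ennreal (exp (t\<^sup>2 * v / 2)) * (\<integral>\<^sup>+z. ennreal (normal_density (t * v) (sqrt v) z) \<partial>lborel)"
    by (rule nn_integral_cmult) simp
  also have "(\<integral>\<^sup>+z. ennreal (normal_density (t * v) (sqrt v) z) \<partial>lborel) = 1"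
    using sv by (subst nn_integral_eq_integral) auto
  finally show ?thesis by simp
qed

lemma iid_gaussian_noiseD:
  assumes "iid_gaussian_noise M n p S w" "i < n"
  shows "S \<in> carrier_mat p p" "transpose_mat S = S" "\<omega> \<in> space M \<Longrightarrow> w i \<omega> \<in> carrier_vec p"
    "a \<in> carrier_vec p \<Longrightarrow> 0 \<le> a \<bullet> (S *\<^sub>v a)"
    "a \<in> carrier_vec p \<Longrightarrow> (\<lambda>\<omega>. a \<bullet> w i \<omega>) \<in> borel_measurable M"
    "a \<in> carrier_vec p \<Longrightarrow> distr M borel (\<lambda>\<omega>. a \<bullet> w i \<omega>) = normal_law 0 (a \<bullet> (S *\<^sub>v a))"
  using assms unfolding iid_gaussian_noise_def gaussian_vector_def by auto

text \<open>Chernoff's method: by independence the moment generating function of the sum factors.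
  The tail is stated with a positive upper bound \<open>V\<close> on the variance, so a form of
  variance 0 needs no separate treatment.\<close>

lemma (in prob_space) gaussian_bilinear_tail:
  assumes noise: "iid_gaussian_noise M n p S w"
    and x: "x \<in> carrier_vec n" and y: "y \<in> carrier_vec p"
    and V: "0 < V" "(x \<bullet> x) * (y \<bullet> (S *\<^sub>v y)) \<le> V" and s: "0 < s"
  shows "prob {\<omega> \<in> space M. s \<le> (\<Sum>i<n. x $ i * (y \<bullet> w i \<omega>))} \<le> exp (- (s\<^sup>2 / (2 * V)))"
proof -
  define q where "q = y \<bullet> (S *\<^sub>v y)"
  \<comment> \<open>The minimiser of \<open>- l * s + l\<^sup>2 * V / 2\<close>, whose minimum is
    the exponent claimed.\<close>
  define l where "l = s / V"
  have l: "l > 0" using s V by (simp add: l_def)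
  note D = iid_gaussian_noiseD[OF noise]
  have [measurable]: "(\<lambda>\<omega>. y \<bullet> w i \<omega>) \<in> borel_measurable M" if "i < n" for i
    using D(5)[OF that y] .
  \<comment> \<open>Independence is given for coordinate tuples in the product space, so
    \<open>y . w i\<close> is replaced by an explicit measurable function of the tuple. The two
    agree on \<open>space M\<close>, where \<open>w i\<close> is known to have dimension
    \<open>p\<close>.\<close>
  define T where "T = (\<lambda>i \<omega>. \<Sum>k<p. y $ k * w i \<omega> $ k)"
  have T: "y \<bullet> w i \<omega> = T i \<omega>" if "i < n" "\<omega> \<in> space M" for i \<omega>
    using D(3)[OF that] by (simp add: T_def scalar_prod_def lessThan_atLeast0)
  have restrict: "(\<Sum>k<p. y $ k * (\<lambda>k\<in>{..<p}. w i \<omega> $ k) k) = T i \<omega>" for i \<omega>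
    unfolding T_def by (rule sum.cong) simp_all
  have "indep_vars (\<lambda>_. Pi\<^sub>M {..<p} (\<lambda>_. borel)) (\<lambda>i \<omega>. \<lambda>k\<in>{..<p}. w i \<omega> $ k) {..<n}"
    using noise by (simp add: iid_gaussian_noise_def)
  then have "indep_vars (\<lambda>_. borel) (\<lambda>i \<omega>. (\<lambda>f. ennreal (exp (l * (x $ i * (\<Sum>k<p. y $ k * f k))))) (\<lambda>k\<in>{..<p}. w i \<omega> $ k)) {..<n}"
    by (rule indep_vars_compose2) measurable
  then have indep: "indep_vars (\<lambda>_. borel) (\<lambda>i \<omega>. ennreal (exp (l * (x $ i * T i \<omega>)))) {..<n}"
    unfolding restrict .
  have mgf: "(\<integral>\<^sup>+\<omega>. ennreal (exp (l * (x $ i * T i \<omega>))) \<partial>M) = ennreal (exp ((l * x $ i)\<^sup>2 * q / 2))"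
    if i: "i < n" for i
  proof -
    have "(\<integral>\<^sup>+\<omega>. ennreal (exp (l * (x $ i * T i \<omega>))) \<partial>M)
      = (\<integral>\<^sup>+\<omega>. ennreal (exp (l * (x $ i * (y \<bullet> w i \<omega>)))) \<partial>M)"
      by (intro nn_integral_cong) (simp add: T[OF i])
    also have "\<dots> = (\<integral>\<^sup>+z. ennreal (exp (l * x $ i * z)) \<partial>distr M borel (\<lambda>\<omega>. y \<bullet> w i \<omega>))"
      using i by (simp add: nn_integral_distr mult.assoc)
    also have "\<dots> = ennreal (exp ((l * x $ i)\<^sup>2 * q / 2))"
      unfolding D(6)[OF i y] q_def by (rule nn_integral_exp_normal_law[OF D(4)[OF i y]])
    finally show ?thesis .
  qed
  have "ennreal (prob {\<omega> \<in> space M. s \<le> (\<Sum>i<n. x $ i * (y \<bullet> w i \<omega>))})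
    = emeasure M {\<omega> \<in> space M. s \<le> (\<Sum>i<n. x $ i * (y \<bullet> w i \<omega>))}"
    by (simp add: emeasure_eq_measure)
  also have "\<dots> \<le> ennreal (exp (- l * s)) * (\<integral>\<^sup>+\<omega>\<in>space M. exp (l * (\<Sum>i<n. x $ i * (y \<bullet> w i \<omega>))) \<partial>M)"
    by (intro Chernoff_ineq_nn_integral_ge l) auto
  also have "(\<integral>\<^sup>+\<omega>\<in>space M. exp (l * (\<Sum>i<n. x $ i * (y \<bullet> w i \<omega>))) \<partial>M)
    = (\<integral>\<^sup>+\<omega>. (\<Prod>i<n. ennreal (exp (l * (x $ i * T i \<omega>)))) \<partial>M)"
    by (intro nn_integral_cong) (simp add: T sum_distrib_left exp_sum prod_ennreal)
  also have "\<dots> = (\<Prod>i<n. \<integral>\<^sup>+\<omega>. ennreal (exp (l * (x $ i * T i \<omega>))) \<partial>M)"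
    by (intro indep_vars_nn_integral indep) auto
  also have "\<dots> = (\<Prod>i<n. ennreal (exp ((l * x $ i)\<^sup>2 * q / 2)))"
    by (intro prod.cong) (auto simp: mgf)
  also have "\<dots> = ennreal (exp (l\<^sup>2 * ((x \<bullet> x) * q) / 2))"
    using x by (simp add: prod_ennreal exp_sum[symmetric] scalar_prod_def lessThan_atLeast0
        sum_distrib_left sum_distrib_right sum_divide_distrib power2_eq_square algebra_simps)
  also have "ennreal (exp (- l * s)) * \<dots> = ennreal (exp (- l * s + l\<^sup>2 * ((x \<bullet> x) * q) / 2))"
    by (subst exp_add, subst ennreal_mult) simp_all
  also have "\<dots> \<le> ennreal (exp (- l * s + l\<^sup>2 * V / 2))"
    using V by (intro ennreal_leI) (simp add: q_def mult_left_mono)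
  also have "- l * s + l\<^sup>2 * V / 2 = - (s\<^sup>2 / (2 * V))"
    using V by (simp add: l_def field_simps power2_eq_square)
  finally show ?thesis by simp
qed

definition noise_matrix :: "nat \<Rightarrow> nat \<Rightarrow> (nat \<Rightarrow> 'a \<Rightarrow> real vec) \<Rightarrow> 'a \<Rightarrow> real mat" where
  "noise_matrix n p w \<omega> = mat_of_cols p (map (\<lambda>i. w i \<omega>) [0..<n])"

lemma noise_matrix_carrier [simp]: "noise_matrix n p w \<omega> \<in> carrier_mat p n"
  using mat_of_cols_carrier(1)[of p "map (\<lambda>i. w i \<omega>) [0..<n]"] by (simp add: noise_matrix_def)

lemma noise_matrix_bilinear:
  assumes "\<And>i. i < n \<Longrightarrow> w i \<omega> \<in> carrier_vec p" "x \<in> carrier_vec n" "y \<in> carrier_vec p"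
  shows "y \<bullet> (noise_matrix n p w \<omega> *\<^sub>v x) = (\<Sum>i<n. x $ i * (y \<bullet> w i \<omega>))"
proof -
  have "y \<bullet> (noise_matrix n p w \<omega> *\<^sub>v x) = (transpose_mat (noise_matrix n p w \<omega>) *\<^sub>v y) \<bullet> x"
    using transpose_vec_mult_scalar[OF noise_matrix_carrier[of n p w \<omega>] assms(2,3)] by simp
  also have "\<dots> = (\<Sum>i<n. (w i \<omega> \<bullet> y) * x $ i)"
    using assms by (simp add: noise_matrix_def scalar_prod_def[of _ x] lessThan_atLeast0)
  also have "\<dots> = (\<Sum>i<n. x $ i * (y \<bullet> w i \<omega>))"
    using assms by (intro sum.cong) (auto simp: comm_scalar_prod[of _ p y])
  finally show ?thesis .
qed

text \<open>The Taylor bound gives \<open>exp 1 >= 5/2\<close>, and \<open>(5/2)^5\<close> is about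
  97.7. This turns the net size \<open>96 ^ (n + p)\<close> into
  \<open>exp (5 (n + p))\<close>.\<close>

lemma exp_5_ge: "(96::real) \<le> exp 5"
proof -
  have "(5 / 2 :: real) ^ 5 \<le> exp 1 ^ 5"
    using exp_lower_Taylor_quadratic[of "1::real"] by (intro power_mono) auto
  then show ?thesis by (simp add: exp_of_nat_mult[symmetric] power_divide)
qed

text \<open>The bound is asserted on a measurable event \<open>G\<close>, built from finitely many
  measurable tails; measurability of the operator norm itself never has to be discussed.\<close>

lemma (in prob_space) noise_matrix_operator_bound:
  assumes noise: "iid_gaussian_noise M n p S w" and dims: "0 < n" "0 < p"
    and a: "0 < a" "a \<le> spectral_norm S"
  shows "\<exists>G \<in> events. 1 - exp (- (real n + real p)) \<le> prob G \<and>
    (\<forall>\<omega>\<in>G. \<forall>x\<in>carrier_vec n.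
      vec_l2 (noise_matrix n p w \<omega> *\<^sub>v x) \<le> 24 / sqrt a * (spectral_norm S * sqrt (real n + real p)) * vec_l2 x)"
proof -
  define N where "N = real n + real p"
  \<comment> \<open>The threshold makes each Gaussian tail at most \<open>exp (- 6 N)\<close>, while the net has at most \<open>exp (5 N)\<close> points.\<close>
  define s where "s = 6 / sqrt a * (spectral_norm S * sqrt N)"
  have N: "N > 0" using dims by (simp add: N_def)
  have S: "S \<in> carrier_mat p p" using iid_gaussian_noiseD[OF noise dims(1)] by simp
  have Spos: "0 < spectral_norm S" using a by simp
  have s: "s > 0" using a Spos N by (simp add: s_def)
  define f where "f = (\<lambda>(x, y) \<omega>. \<Sum>i<n. x $ i * (y \<bullet> w i \<omega>))"
  define bad where "bad = (\<lambda>z. {\<omega> \<in> space M. s \<le> f z \<omega>})"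
  let ?net = "lattice_net n \<times> lattice_net p"
  have f_meas: "f z \<in> borel_measurable M" if "z \<in> ?net" for z
    using that iid_gaussian_noiseD(5)[OF noise] lattice_net_carrier[of "snd z" p]
    by (auto simp: f_def case_prod_beta intro!: borel_measurable_sum borel_measurable_times)
  have bad_meas: "bad z \<in> events" if "z \<in> ?net" for z
    unfolding bad_def using f_meas[OF that] by measurable
  have bad_prob: "prob (bad z) \<le> exp (- (6 * N))" if z: "z \<in> ?net" for z
  proof -
    obtain x y where xy: "z = (x, y)" "x \<in> lattice_net n" "y \<in> lattice_net p" using z by auto
    note carr = lattice_net_carrier[OF xy(2)] lattice_net_carrier[OF xy(3)]
    have xx: "x \<bullet> x \<le> (5 / 4)\<^sup>2"
      using lattice_net_norm[OF xy(2)] unfolding vec_l2_power2[symmetric] by (intro power_mono) auto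
    have yy: "(vec_l2 y)\<^sup>2 \<le> (5 / 4)\<^sup>2"
      using lattice_net_norm[OF xy(3)] by (intro power_mono) auto
    have "y \<bullet> (S *\<^sub>v y) \<le> vec_l2 y * vec_l2 (S *\<^sub>v y)"
      using vec_l2_Cauchy_Schwarz[of y p "S *\<^sub>v y"] carr S by auto
    also have "\<dots> \<le> vec_l2 y * (spectral_norm S * vec_l2 y)"
      using vec_l2_mult_le_spectral_norm[OF S carr(2)] by (intro mult_left_mono) auto
    also have "\<dots> = spectral_norm S * (vec_l2 y)\<^sup>2" by (simp add: power2_eq_square)
    also have "\<dots> \<le> spectral_norm S * (5 / 4)\<^sup>2" using yy Spos by (intro mult_left_mono) auto
    finally have ySy: "y \<bullet> (S *\<^sub>v y) \<le> spectral_norm S * (5 / 4)\<^sup>2" .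
    have "(x \<bullet> x) * (y \<bullet> (S *\<^sub>v y)) \<le> (5 / 4)\<^sup>2 * (spectral_norm S * (5 / 4)\<^sup>2)"
      using xx ySy iid_gaussian_noiseD(4)[OF noise dims(1) carr(2)] by (intro mult_mono) auto
    \<comment> \<open>\<open>(5/4)^4 = 625/256\<close>, which is below 3.\<close>
    also have "\<dots> \<le> 3 * spectral_norm S" using Spos by (simp add: power2_eq_square)
    finally have "prob (bad z) \<le> exp (- (s\<^sup>2 / (2 * (3 * spectral_norm S))))"
      using gaussian_bilinear_tail[OF noise carr _ _ s, of "3 * spectral_norm S"] Spos
      by (simp add: bad_def f_def xy(1))
    also have "\<dots> \<le> exp (- (6 * N))"
    proof -
      have "s\<^sup>2 / (2 * (3 * spectral_norm S)) = 6 * N * (spectral_norm S / a)"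
        using a Spos N by (simp add: s_def power_mult_distrib power_divide power2_eq_square field_simps)
      moreover have "6 * N * 1 \<le> 6 * N * (spectral_norm S / a)"
        using a N by (intro mult_left_mono) auto
      ultimately show ?thesis by simp
    qed
    finally show ?thesis .
  qed
  have fin: "finite ?net" by (simp add: finite_lattice_net)
  have "real (card ?net) \<le> 96 ^ n * 96 ^ p"
    unfolding card_cartesian_product of_nat_mult
    by (intro mult_mono card_lattice_net) auto
  also have "\<dots> \<le> exp 5 ^ (n + p)"
    unfolding power_add[symmetric] using exp_5_ge by (intro power_mono) auto
  also have "\<dots> = exp (5 * N)"
    by (simp add: N_def exp_of_nat_mult[symmetric] mult.commute)
  finally have card: "real (card ?net) \<le> exp (5 * N)" .
  define G where "G = space M - (\<Union>z\<in>?net. bad z)"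
  have U: "(\<Union>z\<in>?net. bad z) \<in> events" using bad_meas fin by blast
  have "prob (\<Union>z\<in>?net. bad z) \<le> (\<Sum>z\<in>?net. prob (bad z))"
    using bad_meas by (intro finite_measure_subadditive_finite fin) auto
  also have "\<dots> \<le> (\<Sum>z\<in>?net. exp (- (6 * N)))"
    by (intro sum_mono bad_prob)
  also have "\<dots> \<le> exp (5 * N) * exp (- (6 * N))"
    using card by (simp add: mult_right_mono)
  also have "\<dots> = exp (- N)" by (simp flip: exp_add)
  finally have "1 - exp (- N) \<le> prob G"
    unfolding G_def using prob_compl[OF U] by simp
  moreover have "G \<in> events" unfolding G_def using U by blast
  moreover have "vec_l2 (noise_matrix n p w \<omega> *\<^sub>v x) \<le> 4 * s * vec_l2 x"
    if \<omega>: "\<omega> \<in> G" and x: "x \<in> carrier_vec n" for \<omega> x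
  proof (rule operator_bound_from_net[OF noise_matrix_carrier dims(2,1) less_imp_le[OF s] _ x])
    fix u v assume uv: "u \<in> lattice_net n" "v \<in> lattice_net p"
    have space: "\<omega> \<in> space M" and "\<omega> \<notin> bad (u, v)" using \<omega> uv by (auto simp: G_def)
    then have "f (u, v) \<omega> \<le> s" by (auto simp: bad_def)
    then show "v \<bullet> (noise_matrix n p w \<omega> *\<^sub>v u) \<le> s"
      using noise_matrix_bilinear[of n w \<omega> p u v] uv[THEN lattice_net_carrier]
        iid_gaussian_noiseD(3)[OF noise _ space] by (simp add: f_def)
  qed
  moreover have "4 * s = 24 / sqrt a * (spectral_norm S * sqrt N)"
    by (simp add: s_def)
  ultimately show ?thesis unfolding N_def[symmetric] by auto
qed

section \<open>Measurability and expectations\<close>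

text \<open>Weyl's inequality in both directions, with the entry sum as operator bound on the
  difference.\<close>

lemma singular_value_entrywise_Lipschitz:
  assumes A: "A \<in> carrier_mat p n" and B: "B \<in> carrier_mat p n" and n: "2 \<le> n" and k: "k \<in> {1, 2}"
  shows "\<bar>singular_value A k - singular_value B k\<bar> \<le> (\<Sum>i<p. \<Sum>j<n. \<bar>A $$ (i, j) - B $$ (i, j)\<bar>)"
proof -
  let ?\<delta> = "\<Sum>i<p. \<Sum>j<n. \<bar>A $$ (i, j) - B $$ (i, j)\<bar>"
  have "vec_l2 ((A - B) *\<^sub>v x) \<le> ?\<delta> * vec_l2 x" if "x \<in> carrier_vec n" for x
    using vec_l2_mult_mat_vec_le_entries[OF minus_carrier_mat[OF B] that, of A] A B by simp
  moreover have "vec_l2 ((B - A) *\<^sub>v x) \<le> ?\<delta> * vec_l2 x" if "x \<in> carrier_vec n" for x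
    using vec_l2_mult_mat_vec_le_entries[OF minus_carrier_mat[OF A] that, of B] A B by (simp add: abs_minus_commute)
  ultimately show ?thesis
    using singular_value_perturb[OF A B n _ k, of ?\<delta>] singular_value_perturb[OF B A n _ k, of ?\<delta>]
    by (simp add: abs_le_iff)
qed

text \<open>Sorting polynomial roots gives no direct access to measurability. The Lipschitz bound
  makes the singular value a continuous function of the entries, which is then composed with the
  measurable entries.\<close>

lemma singular_value_measurable:
  assumes carrier: "\<And>\<omega>. \<omega> \<in> space M \<Longrightarrow> X \<omega> \<in> carrier_mat p n"
    and entries: "\<And>i j. i < p \<Longrightarrow> j < n \<Longrightarrow> (\<lambda>\<omega>. X \<omega> $$ (i, j)) \<in> borel_measurable M"
    and n: "2 \<le> n" and k: "k \<in> {1, 2}"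
  shows "(\<lambda>\<omega>. singular_value (X \<omega>) k) \<in> borel_measurable M"
proof -
  define g :: "(nat \<times> nat \<Rightarrow> real) \<Rightarrow> real" where "g = (\<lambda>\<phi>. singular_value (Matrix.mat p n \<phi>) k)"
  have lip: "norm (g \<phi> - g \<psi>) \<le> (\<Sum>i<p. \<Sum>j<n. \<bar>\<phi> (i, j) - \<psi> (i, j)\<bar>)" for \<phi> \<psi>
    using singular_value_entrywise_Lipschitz[of "Matrix.mat p n \<phi>" p n "Matrix.mat p n \<psi>" k] n k
    by (simp add: g_def)
  have "continuous_on UNIV g"
    unfolding continuous_on_def
  proof
    fix \<psi> :: "nat \<times> nat \<Rightarrow> real"
    have coord: "((\<lambda>\<phi>. \<phi> z) \<longlongrightarrow> \<psi> z) (at \<psi> within UNIV)" for z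
      using continuous_on_product_coordinates[of z] unfolding continuous_on_def by blast
    have "((\<lambda>\<phi>. \<Sum>i<p. \<Sum>j<n. \<bar>\<phi> (i, j) - \<psi> (i, j)\<bar>) \<longlongrightarrow> (\<Sum>i<p. \<Sum>j<n. \<bar>\<psi> (i, j) - \<psi> (i, j)\<bar>)) (at \<psi> within UNIV)"
      by (intro tendsto_intros coord)
    then have "((\<lambda>\<phi>. \<Sum>i<p. \<Sum>j<n. \<bar>\<phi> (i, j) - \<psi> (i, j)\<bar>) \<longlongrightarrow> 0) (at \<psi> within UNIV)"
      by simp
    then have "((\<lambda>\<phi>. g \<phi> - g \<psi>) \<longlongrightarrow> 0) (at \<psi> within UNIV)"
      by (rule Lim_null_comparison[rotated]) (intro always_eventually allI lip)
    then show "(g \<longlongrightarrow> g \<psi>) (at \<psi> within UNIV)"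
      by (simp add: LIM_zero_iff)
  qed
  then have g: "g \<in> borel_measurable borel" by (rule borel_measurable_continuous_onI)
  \<comment> \<open>Entries are extended by 0 to all index pairs, giving a map into functions on the
    countable type of pairs; such a map is Borel as soon as each coordinate is.\<close>
  define f where "f = (\<lambda>\<omega> z. if fst z < p \<and> snd z < n then X \<omega> $$ z else 0)"
  have f: "f \<in> borel_measurable M"
  proof (rule measurable_coordinatewise_then_product)
    fix z :: "nat \<times> nat"
    show "(\<lambda>\<omega>. f \<omega> z) \<in> borel_measurable M"
      using entries[of "fst z" "snd z"] by (cases "fst z < p \<and> snd z < n") (auto simp: f_def)
  qed
  have "(\<lambda>\<omega>. g (f \<omega>)) \<in> borel_measurable M"
    using measurable_compose[OF f g] .
  moreover have "g (f \<omega>) = singular_value (X \<omega>) k" if "\<omega> \<in> space M" for \<omega>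
  proof -
    have "Matrix.mat p n (f \<omega>) = X \<omega>"
      using carrier[OF that] by (intro eq_matI) (auto simp: f_def)
    then show ?thesis by (simp add: g_def)
  qed
  ultimately show ?thesis
    by (rule measurable_cong[THEN iffD1, rotated])
qed

text \<open>A bound on all eigenvalues says something only if there is one. For positive
  \<open>p\<close> the splitting of the characteristic polynomial provides it, and its eigenvector
  tests the norm.\<close>

lemma spectral_norm_ge_eigenvalues:
  assumes S: "S \<in> carrier_mat p p" "transpose_mat S = S" and p: "0 < p"
    and a: "\<And>k. eigenvalue S k \<Longrightarrow> a \<le> k"
  shows "a \<le> spectral_norm S"
proof -
  obtain es where es: "char_poly S = (\<Prod>e\<leftarrow>es. [:- e, 1:])" "length es = p"
    using symmetric_char_poly_splits[OF S] .
  then obtain k where "k \<in> set es" using p by (metis length_greater_0_conv list.set_sel(1))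
  then have "poly (char_poly S) k = 0"
    unfolding es(1) by (auto simp: poly_prod_list prod_list_zero_iff)
  then have ev: "eigenvalue S k" using eigenvalue_root_char_poly[OF S(1)] by simp
  then obtain v where v: "v \<in> carrier_vec p" "v \<noteq> 0\<^sub>v p" "S *\<^sub>v v = k \<cdot>\<^sub>v v"
    using S unfolding eigenvalue_def eigenvector_def by auto
  have "vec_l2 v \<noteq> 0"
    using conjugate_square_eq_0_vec[OF v(1)] v(2) vec_l2_power2[of v] by auto
  then have "0 < vec_l2 v" using vec_l2_nonneg[of v] by linarith
  moreover have "\<bar>k\<bar> * vec_l2 v \<le> spectral_norm S * vec_l2 v"
    using vec_l2_mult_le_spectral_norm[OF S(1) v(1)] v(3) by (simp add: vec_l2_smult)
  ultimately show ?thesis using a[OF ev] by simp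
qed

section \<open>Means of the noise and of the data matrix\<close>

lemma normal_law_mean_zero:
  assumes "0 \<le> v"
  shows "integrable (normal_law 0 v) (\<lambda>z. z)" "(\<integral>z. z \<partial>normal_law 0 v) = 0"
proof -
  have "integrable (normal_law 0 v) (\<lambda>z. z) \<and> (\<integral>z. z \<partial>normal_law 0 v) = 0"
  proof (cases "v = 0")
    case True
    then show ?thesis
      by (simp add: normal_law_def integral_return integrable_iff_bounded nn_integral_return)
  next
    case False
    then have "0 < sqrt v" using assms by simp
    then show ?thesis
      using False integrable_normal_moment_nz_1[of "sqrt v" 0] integral_normal_moment_nz_1[of "sqrt v" 0]
      by (simp add: normal_law_def integrable_density integral_density)
  qed
  then show "integrable (normal_law 0 v) (\<lambda>z. z)" "(\<integral>z. z \<partial>normal_law 0 v) = 0" by auto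
qed

lemma gaussian_noise_entry:
  assumes noise: "iid_gaussian_noise M n p S w" and i: "i < n" and k: "k < p"
  shows "(\<lambda>\<omega>. w i \<omega> $ k) \<in> borel_measurable M" "integrable M (\<lambda>\<omega>. w i \<omega> $ k)"
    "(\<integral>\<omega>. w i \<omega> $ k \<partial>M) = 0"
proof -
  let ?u = "unit_vec p k :: real vec"
  have u: "?u \<in> carrier_vec p" by simp
  note D = iid_gaussian_noiseD[OF noise i]
  have eq: "w i \<omega> $ k = ?u \<bullet> w i \<omega>" if "\<omega> \<in> space M" for \<omega>
    using D(3)[OF that] k by simp
  have meas: "(\<lambda>\<omega>. ?u \<bullet> w i \<omega>) \<in> borel_measurable M" by (rule D(5)[OF u])
  note law = normal_law_mean_zero[OF D(4)[OF u], folded D(6)[OF u]]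
  show "(\<lambda>\<omega>. w i \<omega> $ k) \<in> borel_measurable M"
    using meas by (simp add: eq cong: measurable_cong)
  show "integrable M (\<lambda>\<omega>. w i \<omega> $ k)"
    using law(1) meas by (simp add: integrable_distr_eq eq cong: Bochner_Integration.integrable_cong)
  show "(\<integral>\<omega>. w i \<omega> $ k \<partial>M) = 0"
    using law(2) meas by (simp add: integral_distr eq cong: Bochner_Integration.integral_cong)
qed

lemma data_matrix_carrier [simp]: "data_matrix n p Y m1 m2 w \<omega> \<in> carrier_mat p n"
  using mat_of_cols_carrier(1)[of p "map (\<lambda>i. Y i \<cdot>\<^sub>v m1 + (1 - Y i) \<cdot>\<^sub>v m2 + w i \<omega>) [0..<n]"]
  by (simp add: data_matrix_def)

lemma data_matrix_entry:
  assumes "m1 \<in> carrier_vec p" "m2 \<in> carrier_vec p" "w i \<omega> \<in> carrier_vec p" "i < n" "k < p"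
  shows "data_matrix n p Y m1 m2 w \<omega> $$ (k, i) = Y i * m1 $ k + (1 - Y i) * m2 $ k + w i \<omega> $ k"
  using assms by (simp add: data_matrix_def mat_of_cols_index)

lemma expectation_mat_carrier [simp]: "expectation_mat M r s A \<in> carrier_mat r s"
  by (simp add: expectation_mat_def)

context
  fixes M :: "'a measure" and n p :: nat and Y :: "nat \<Rightarrow> real" and m1 m2 :: "real vec" and S :: "real mat"
    and w :: "nat \<Rightarrow> 'a \<Rightarrow> real vec"
  assumes M: "prob_space M" and noise: "iid_gaussian_noise M n p S w"
    and means: "m1 \<in> carrier_vec p" "m2 \<in> carrier_vec p"
begin

interpretation prob_space M by (rule M)

lemma data_matrix_entry_measurable:
  assumes "i < p" "j < n"
  shows "(\<lambda>\<omega>. data_matrix n p Y m1 m2 w \<omega> $$ (i, j)) \<in> borel_measurable M"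
proof -
  have "(\<lambda>\<omega>. Y j * m1 $ i + (1 - Y j) * m2 $ i + w j \<omega> $ i) \<in> borel_measurable M"
    using gaussian_noise_entry(1)[OF noise assms(2,1)] by simp
  then show ?thesis
    by (rule measurable_cong[THEN iffD1, rotated])
       (simp add: data_matrix_entry means assms iid_gaussian_noiseD(3)[OF noise])
qed

lemma expectation_data_matrix_entry:
  assumes "i < p" "j < n"
  shows "(\<integral>\<omega>. data_matrix n p Y m1 m2 w \<omega> $$ (i, j) \<partial>M) = Y j * m1 $ i + (1 - Y j) * m2 $ i"
proof -
  have "(\<integral>\<omega>. data_matrix n p Y m1 m2 w \<omega> $$ (i, j) \<partial>M)
    = (\<integral>\<omega>. (Y j * m1 $ i + (1 - Y j) * m2 $ i) + w j \<omega> $ i \<partial>M)"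
    by (rule Bochner_Integration.integral_cong)
       (simp_all add: data_matrix_entry means assms iid_gaussian_noiseD(3)[OF noise])
  then show ?thesis
    using gaussian_noise_entry(2,3)[OF noise assms(2,1)] by (simp add: prob_space)
qed

lemma data_matrix_minus_expectation:
  assumes "\<omega> \<in> space M"
  shows "data_matrix n p Y m1 m2 w \<omega> - expectation_mat M p n (data_matrix n p Y m1 m2 w) = noise_matrix n p w \<omega>"
    (is "?X - ?E = ?W")
proof (rule eq_matI)
  fix i j assume "i < dim_row ?W" "j < dim_col ?W"
  then have "i < p" "j < n" by (simp_all add: noise_matrix_def)
  then show "(?X - ?E) $$ (i, j) = ?W $$ (i, j)"
    using carrier_matD[OF data_matrix_carrier[of n p Y m1 m2 w \<omega>]] iid_gaussian_noiseD(3)[OF noise _ assms]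
    by (simp add: expectation_mat_def expectation_data_matrix_entry noise_matrix_def mat_of_cols_index data_matrix_entry means)
qed (simp_all add: expectation_mat_def noise_matrix_def)

lemma expectation_symmetric_dilation:
  "expectation_mat M (n + p) (n + p) (\<lambda>\<omega>. symmetric_dilation (data_matrix n p Y m1 m2 w \<omega>))
    = symmetric_dilation (expectation_mat M p n (data_matrix n p Y m1 m2 w))"
proof -
  have dims: "dim_row (data_matrix n p Y m1 m2 w \<omega>) = p" "dim_col (data_matrix n p Y m1 m2 w \<omega>) = n" for \<omega>
    by (simp_all add: carrier_matD[OF data_matrix_carrier])
  show ?thesis
    by (rule eq_matI) (auto simp: expectation_mat_def symmetric_dilation_def dims)
qed

end

section \<open>The eigenvalue ratio and the overlap of eigenvectors\<close>

lemma vec_l2_minus_mat_commute: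
  assumes "A \<in> carrier_mat p n" "B \<in> carrier_mat p n" "x \<in> carrier_vec n"
  shows "vec_l2 ((A - B) *\<^sub>v x) = vec_l2 ((B - A) *\<^sub>v x)"
proof -
  have "(A - B) *\<^sub>v x = (-1) \<cdot>\<^sub>v ((B - A) *\<^sub>v x)"
    using assms by (simp add: minus_mult_distrib_mat_vec[of _ p n]) (intro eq_vecI, auto)
  then show ?thesis by (simp add: vec_l2_smult)
qed

lemma ext_ratio_geD:
  assumes "ereal (1 + c) \<le> ext_ratio a b" "0 \<le> b" "0 \<le> a"
  shows "(1 + c) * b \<le> a"
proof (cases "b = 0")
  case False
  then show ?thesis using assms by (simp add: ext_ratio_def field_simps)
qed (use assms in simp)

text \<open>Positivity of \<open>a\<close> matters when \<open>b = 0\<close>: then the ratio is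
  infinite, while \<open>0/0\<close> would be 0.\<close>

lemma ext_ratio_geI:
  assumes "r * b \<le> a" "0 \<le> b" "0 < a"
  shows "ereal r \<le> ext_ratio a b"
proof (cases "b = 0")
  case True
  then show ?thesis using assms by (simp add: ext_ratio_def divide_ereal_def)
next
  case False
  then show ?thesis using assms by (simp add: ext_ratio_def field_simps)
qed

text \<open>After multiplication by \<open>1 + c\<close>, the margin between \<open>1 + c\<close>
  and \<open>1 + c/2\<close> is worth \<open>c * d1 / 2\<close>. The errors in \<open>t1\<close> and
  \<open>t2\<close> together cost \<open>(4 + c) * (1 + c) * \<delta> / 2\<close>, and the last
  hypothesis says that the margin pays for them.\<close>

lemma ratio_perturb:
  fixes c d1 d2 t1 t2 \<delta> :: real
  assumes c: "0 < c" and d: "(1 + c) * d2 \<le> d1" and t: "d1 - \<delta> \<le> t1" "t2 \<le> d2 + \<delta>"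
    and \<delta>: "(4 + c) * (1 + c) * \<delta> \<le> c * d1"
  shows "(1 + c / 2) * t2 \<le> t1"
proof -
  have "(1 + c) * ((1 + c / 2) * t2) \<le> (1 + c) * ((1 + c / 2) * (d2 + \<delta>))"
    using c t by (intro mult_left_mono) auto
  also have "\<dots> = (1 + c / 2) * ((1 + c) * d2) + (1 + c) * (1 + c / 2) * \<delta>"
    by (simp add: field_simps)
  also have "\<dots> \<le> (1 + c / 2) * d1 + (1 + c) * (1 + c / 2) * \<delta>"
    using c d by (intro add_right_mono mult_left_mono) auto
  also have "\<dots> \<le> (1 + c) * (d1 - \<delta>)"
  proof -
    have "(1 + c) * (1 + c / 2) * \<delta> + (1 + c) * \<delta> = (4 + c) * (1 + c) * \<delta> / 2"
      "(1 + c / 2) * d1 + c * d1 / 2 = (1 + c) * d1" "(1 + c) * (d1 - \<delta>) = (1 + c) * d1 - (1 + c) * \<delta>"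
      by (simp_all add: field_simps)
    then show ?thesis using \<delta> by linarith
  qed
  also have "\<dots> \<le> (1 + c) * t1"
    using c t by (intro mult_left_mono) auto
  finally show ?thesis using c by simp
qed

text \<open>Equal entries determine the upper block of \<open>v\<close> up to sign, so the overlap
  with the indicator is the modulus of \<open>e . x\<close> for the unit constant vector
  \<open>e\<close>. Its largest possible value is \<open>|x| = sqrt (1/2)\<close>, and the
  perturbation bound limits the deficit.\<close>

lemma top_eigenvector_overlap:
  fixes c \<delta> :: real
  defines "\<kappa> \<equiv> 1 - 1 / (1 + c)\<^sup>2"
  assumes A: "A \<in> carrier_mat p n" and X: "X \<in> carrier_mat p n" and n: "2 \<le> n"
    and \<delta>: "\<And>x. x \<in> carrier_vec n \<Longrightarrow> vec_l2 ((X - A) *\<^sub>v x) \<le> \<delta> * vec_l2 x"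
    and c: "0 < c" and gap: "(1 + c) * singular_value A 2 \<le> singular_value A 1"
    and small: "2 * \<delta> \<le> singular_value A 1"
    and d1: "0 < singular_value A 1" and t1: "0 < singular_value X 1"
    and v: "unit_eigenvector (symmetric_dilation A) v (singular_value A 1)"
    and equal: "\<forall>i<n. \<forall>j<n. v $ i = v $ j"
    and vhat: "unit_eigenvector (symmetric_dilation X) vhat (singular_value X 1)"
  shows "\<bar>sqrt (1 / real n) * \<bar>block_indicator n p \<bullet> vhat\<bar> - sqrt (1 / 2)\<bar>
    \<le> 4 * \<delta> / (\<kappa> * singular_value A 1)"
proof -
  let ?d1 = "singular_value A 1" and ?d2 = "singular_value A 2"
  have \<kappa>: "0 < \<kappa>" using c by (simp add: \<kappa>_def)
  have d2: "0 \<le> ?d2" by (rule singular_value_2_nonneg[OF A n])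
  have AX: "vec_l2 ((A - X) *\<^sub>v x) \<le> \<delta> * vec_l2 x" if "x \<in> carrier_vec n" for x
    using \<delta>[OF that] vec_l2_minus_mat_commute[OF A X that] by simp
  obtain a b where ab: "v = a @\<^sub>v b" "a \<in> carrier_vec n" "b \<in> carrier_vec p" "a \<bullet> a = 1 / 2"
    "transpose_mat A *\<^sub>v b = ?d1 \<cdot>\<^sub>v a" "A *\<^sub>v a = ?d1 \<cdot>\<^sub>v b"
    by (rule symmetric_dilation_eigenvector[OF A v d1])
  obtain x y where xy: "vhat = x @\<^sub>v y" "x \<in> carrier_vec n" "y \<in> carrier_vec p" "x \<bullet> x = 1 / 2" "y \<bullet> y = 1 / 2"
    "X *\<^sub>v x = singular_value X 1 \<cdot>\<^sub>v y"
    by (rule symmetric_dilation_eigenvector[OF X vhat t1])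
  define a0 where "a0 = a $ 0"
  have ai: "a $ i = a0" if i: "i < n" for i
  proof -
    have "v $ i = a $ i" "v $ 0 = a $ 0" using i ab(1-3) by simp_all
    then show ?thesis using equal i n by (metis a0_def gr0I not_less_zero)
  qed
  have a0: "real n * a0\<^sup>2 = 1 / 2"
    using ab(2,4) ai by (simp add: scalar_prod_def power2_eq_square)
  have a0_nz: "a0 \<noteq> 0" using a0 by auto
  \<comment> \<open>Scaling by the signed \<open>a0\<close> makes \<open>e\<close> the constant
    vector \<open>1 / sqrt n\<close>, whatever the sign of \<open>v\<close>.\<close>
  define r where "r = 1 / (a0 * sqrt (real n))"
  define e where "e = r \<cdot>\<^sub>v a"
  have e: "e \<in> carrier_vec n" using ab by (simp add: e_def)
  have ei: "e $ i = 1 / sqrt (real n)" if "i < n" for i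
    using that ab(2) ai a0_nz by (simp add: e_def r_def)
  have ee: "e \<bullet> e = 1"
    using e ei n by (simp add: scalar_prod_def)
  have tA: "transpose_mat A \<in> carrier_mat n p" using A by simp
  have eig: "transpose_mat A *\<^sub>v (A *\<^sub>v e) = ?d1\<^sup>2 \<cdot>\<^sub>v e"
    using ab by (simp add: e_def mult_mat_vec[OF A] mult_mat_vec[OF tA] smult_smult_assoc power2_eq_square mult.commute mult.left_commute)
  have norm_x: "(vec_l2 x)\<^sup>2 = 1 / 2" using xy by (simp add: vec_l2_power2)
  have "vec_l2 x = sqrt (1 / 2)" "vec_l2 y = sqrt (1 / 2)"
    by (simp_all only: vec_l2_def xy(4,5))
  then have "vec_l2 (X *\<^sub>v x) = singular_value X 1 * vec_l2 x"
    using t1 by (simp only: xy(6) vec_l2_smult abs_of_pos)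
  moreover have "?d2 < ?d1"
  proof (cases "?d2 = 0")
    case False
    then have "0 < c * ?d2" using c d2 by simp
    then show ?thesis using gap by (simp add: distrib_right)
  qed (use d1 in simp)
  ultimately have main: "(?d1\<^sup>2 - ?d2\<^sup>2) * (1 / 2 - (e \<bullet> x)\<^sup>2) \<le> 2 * \<delta> * ?d1"
    using top_right_singular_vector_perturb[OF A X n AX \<delta> _ small e eig ee xy(2)] norm_x by simp
  define \<alpha> where "\<alpha> = \<bar>e \<bullet> x\<bar>"
  have \<alpha>: "\<alpha>\<^sup>2 \<le> 1 / 2" "0 \<le> \<alpha>"
  proof -
    have "\<alpha> \<le> vec_l2 x"
      using vec_l2_Cauchy_Schwarz[OF e xy(2)] ee by (simp add: \<alpha>_def vec_l2_def[of e])
    then show "\<alpha>\<^sup>2 \<le> 1 / 2" using norm_x power_mono[of \<alpha> "vec_l2 x" 2] by (simp add: \<alpha>_def)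
  qed (simp add: \<alpha>_def)
  \<comment> \<open>The relative gap becomes a gap of squares: \<kappa> is the constant with
    \<open>d1^2 - d2^2 >= \<kappa> d1^2\<close>, also when \<open>d2 = 0\<close>.\<close>
  have "?d2 \<le> ?d1 / (1 + c)" using gap c by (simp add: field_simps)
  then have "?d2\<^sup>2 \<le> ?d1\<^sup>2 / (1 + c)\<^sup>2"
    using d2 power_mono[of ?d2 "?d1 / (1 + c)" 2] by (simp add: power_divide)
  then have "\<kappa> * ?d1\<^sup>2 \<le> ?d1\<^sup>2 - ?d2\<^sup>2" by (simp add: \<kappa>_def algebra_simps)
  then have "\<kappa> * ?d1\<^sup>2 * (1 / 2 - \<alpha>\<^sup>2) \<le> (?d1\<^sup>2 - ?d2\<^sup>2) * (1 / 2 - \<alpha>\<^sup>2)"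
    using \<alpha> by (intro mult_right_mono) auto
  also have "\<dots> \<le> 2 * \<delta> * ?d1" using main by (simp add: \<alpha>_def)
  finally have "?d1 * (\<kappa> * ?d1 * (1 / 2 - \<alpha>\<^sup>2)) \<le> ?d1 * (2 * \<delta>)"
    by (simp add: power2_eq_square algebra_simps)
  then have "\<kappa> * ?d1 * (1 / 2 - \<alpha>\<^sup>2) \<le> 2 * \<delta>" using d1 by simp
  then have defect: "1 / 2 - \<alpha>\<^sup>2 \<le> 2 * \<delta> / (\<kappa> * ?d1)"
    using \<kappa> d1 by (simp add: field_simps)
  define h where "h = sqrt (1 / 2 :: real)"
  have h: "h\<^sup>2 = 1 / 2" "1 / 2 \<le> h"
    unfolding h_def by (simp, rule real_le_rsqrt, simp add: power2_eq_square)
  have \<alpha>_le: "\<alpha> \<le> h" unfolding h_def using \<alpha> by (intro real_le_rsqrt)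
  \<comment> \<open>Since \<open>h + \<alpha>\<close> is at least \<open>1/2\<close>, passing from
    the difference of squares to the difference itself costs a factor 2.\<close>
  have "(h - \<alpha>) * (1 / 2) \<le> (h - \<alpha>) * (h + \<alpha>)"
    using h \<alpha> \<alpha>_le by (intro mult_left_mono) auto
  also have "\<dots> = 1 / 2 - \<alpha>\<^sup>2"
    unfolding h(1)[symmetric] by (simp add: algebra_simps power2_eq_square)
  finally have "\<bar>\<alpha> - h\<bar> \<le> 2 * (2 * \<delta> / (\<kappa> * ?d1))"
    using defect \<alpha>_le by (simp add: abs_if)
  moreover have "sqrt (1 / real n) * \<bar>block_indicator n p \<bullet> vhat\<bar> = \<alpha>"
  proof -
    have "block_indicator n p = Matrix.vec n (\<lambda>_. 1) @\<^sub>v 0\<^sub>v p"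
      by (rule eq_vecI) (auto simp: block_indicator_def)
    then have "block_indicator n p \<bullet> vhat = (\<Sum>i = 0..<n. x $ i)"
      unfolding xy(1) using xy(2,3) scalar_prod_append[of "Matrix.vec n (\<lambda>_. 1)" n "0\<^sub>v p" p x y]
      by (simp add: scalar_prod_def[of _ x])
    moreover have "e \<bullet> x = (\<Sum>i = 0..<n. x $ i) / sqrt (real n)"
      using xy(2) ei by (simp add: scalar_prod_def sum_divide_distrib)
    ultimately show ?thesis by (simp add: \<alpha>_def real_sqrt_divide)
  qed
  ultimately show ?thesis by (simp add: h_def)
qed

text \<open>Squared, the claim becomes \<open>8 K^2 / \<kappa>^2 <= d / \<sigma>\<close>: a rate
  linear in \<open>\<sigma> / d\<close> lies below its square root once \<open>d / \<sigma>\<close>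
  exceeds a constant.\<close>

lemma overlap_bound_le_sqrt:
  fixes K \<kappa> \<sigma> d :: real
  assumes "0 < K" "0 < \<kappa>" "0 < \<sigma>" "0 < d" "8 * K\<^sup>2 / \<kappa>\<^sup>2 \<le> d / \<sigma>"
  shows "4 * (K * \<sigma>) / (\<kappa> * d) \<le> sqrt (2 * \<sigma> / d)"
proof (rule real_le_rsqrt)
  have "(4 * (K * \<sigma>) / (\<kappa> * d))\<^sup>2 = 8 * K\<^sup>2 / \<kappa>\<^sup>2 * (2 * \<sigma>\<^sup>2 / d\<^sup>2)"
    by (simp add: power_divide power_mult_distrib)
  also have "\<dots> \<le> d / \<sigma> * (2 * \<sigma>\<^sup>2 / d\<^sup>2)"
    using assms by (intro mult_right_mono) auto
  also have "\<dots> = 2 * \<sigma> / d"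
    using assms by (simp add: power2_eq_square field_simps)
  finally show "(4 * (K * \<sigma>) / (\<kappa> * d))\<^sup>2 \<le> 2 * \<sigma> / d" .
qed

theorem theorem3:
  fixes M :: "nat \<Rightarrow> 'a measure"
    and p :: "nat \<Rightarrow> nat"
    and Y :: "nat \<Rightarrow> nat \<Rightarrow> real"
    and \<mu>1 \<mu>2 :: "nat \<Rightarrow> real vec"
    and S :: "nat \<Rightarrow> real mat"
    and w :: "nat \<Rightarrow> nat \<Rightarrow> 'a \<Rightarrow> real vec"
    and X Z :: "nat \<Rightarrow> 'a \<Rightarrow> real mat"
    and E_X E_Z :: "nat \<Rightarrow> real mat"
    and \<sigma> d1 d2 :: "nat \<Rightarrow> real"
    and t1 t2 :: "nat \<Rightarrow> 'a \<Rightarrow> real"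
    and c :: real
  assumes prob: "\<And>n. n \<ge> 1 \<Longrightarrow> prob_space (M n)"
    and labels: "\<And>n i. n \<ge> 1 \<Longrightarrow> i < n \<Longrightarrow> Y n i \<in> {0, 1}"
    and means: "\<And>n. n \<ge> 1 \<Longrightarrow> \<mu>1 n \<in> carrier_vec (p n) \<and> \<mu>2 n \<in> carrier_vec (p n)"
    and means_neq: "\<And>n. n \<ge> 1 \<Longrightarrow> \<mu>1 n \<noteq> \<mu>2 n \<and> \<mu>2 n \<noteq> 0\<^sub>v (p n)"
    and noise: "\<And>n. n \<ge> 1 \<Longrightarrow> iid_gaussian_noise (M n) n (p n) (S n) (w n)"
    and X: "\<And>n \<omega>. X n \<omega> = data_matrix n (p n) (Y n) (\<mu>1 n) (\<mu>2 n) (w n) \<omega>"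
    and Z: "\<And>n \<omega>. Z n \<omega> = symmetric_dilation (X n \<omega>)"
    and E_X: "\<And>n. E_X n = expectation_mat (M n) (p n) n (X n)"
    and E_Z: "\<And>n. E_Z n = expectation_mat (M n) (n + p n) (n + p n) (Z n)"
    and sigma: "\<And>n. n \<ge> 1 \<Longrightarrow>
          \<sigma> n > 0 \<and> (\<sigma> n)\<^sup>2 = (spectral_norm (S n))\<^sup>2 * (real n + real (p n))"
    and d: "\<And>n. d1 n = singular_value (E_X n) 1 \<and> d2 n = singular_value (E_X n) 2"
    and t: "\<And>n \<omega>. t1 n \<omega> = singular_value (X n \<omega>) 1 \<and> t2 n \<omega> = singular_value (X n \<omega>) 2"
    and S_bounds: "\<exists>a > 0. \<exists>b. \<forall>n \<ge> 1. \<forall>k. eigenvalue (S n) k \<longrightarrow> a \<le> k \<and> k \<le> b"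
    and p_bounds: "\<exists>C > 0. \<forall>n \<ge> 1. real n powr (1 / C) \<le> real (p n) \<and> real (p n) \<le> real n powr C"
    and d1_large: "filterlim (\<lambda>n. d1 n / \<sigma> n) at_top sequentially"
    and c_pos: "c > 0"
    and gap: "\<And>n. n \<ge> 1 \<Longrightarrow> ext_ratio (d1 n) (d2 n) \<ge> ereal (1 + c)"
  shows "\<forall>D > 0. \<exists>n0 :: nat. \<forall>n \<ge> n0.
     measure (M n) {\<omega> \<in> space (M n). ext_ratio (t1 n \<omega>) (t2 n \<omega>) \<ge> ereal (1 + c / 2)}
       \<ge> 1 - real n powr (- D)
     \<and> (\<forall>v1 vhat1.
          unit_eigenvector (E_Z n) v1 (d1 n) \<longrightarrow>
          (\<forall>i < n. \<forall>j < n. v1 $ i = v1 $ j) \<longrightarrow>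
          (\<forall>\<omega> \<in> space (M n). unit_eigenvector (Z n \<omega>) (vhat1 \<omega>) (t1 n \<omega>)) \<longrightarrow>
          (\<forall>i < n + p n. (\<lambda>\<omega>. vhat1 \<omega> $ i) \<in> borel_measurable (M n)) \<longrightarrow>
          measure (M n)
            {\<omega> \<in> space (M n).
               \<bar>sqrt (1 / real n) * \<bar>block_indicator n (p n) \<bullet> vhat1 \<omega>\<bar> - sqrt (1 / 2)\<bar>
                 \<le> sqrt (2 * \<sigma> n / d1 n)}
            \<ge> 1 - real n powr (- D))"
proof (intro allI impI)
  fix D :: real
  assume "D > 0"
  obtain a where a: "0 < a" "\<And>n k. n \<ge> 1 \<Longrightarrow> eigenvalue (S n) k \<Longrightarrow> a \<le> k"
    using S_bounds by metis
  obtain C where C: "C > 0" "\<And>n. n \<ge> 1 \<Longrightarrow> real n powr (1 / C) \<le> real (p n)"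
    using p_bounds by metis
  define K where "K = 24 / sqrt a"
  define \<kappa> where "\<kappa> = 1 - 1 / (1 + c)\<^sup>2"
  have K: "0 < K" and \<kappa>: "0 < \<kappa>" using a c_pos by (auto simp: K_def \<kappa>_def)
  \<comment> \<open>A sum of three nonnegative thresholds for \<open>d1 / \<sigma>\<close>, so it
    dominates each: the first is what \<open>ratio_perturb\<close> asks for, the second what
    \<open>overlap_bound_le_sqrt\<close> asks for, and the third gives
    \<open>4 * \<delta> <= d1\<close>, hence positivity of \<open>d1\<close> and of
    \<open>t1\<close>.\<close>
  define R where "R = (4 + c) * (1 + c) * K / c + 8 * K\<^sup>2 / \<kappa>\<^sup>2 + 4 * K"
  have "eventually (\<lambda>n. R \<le> d1 n / \<sigma> n) sequentially"
    using d1_large by (simp add: filterlim_at_top)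
  moreover have "eventually (\<lambda>n. exp (- real n) \<le> real n powr (- D)) sequentially"
    by real_asymp
  \<comment> \<open>\<open>2 <= n\<close> is included because the facts on second singular values
    assume two columns.\<close>
  ultimately have "eventually (\<lambda>n. R \<le> d1 n / \<sigma> n \<and> exp (- real n) \<le> real n powr (- D) \<and> 2 \<le> n) sequentially"
    using eventually_ge_at_top[of "2::nat"] by eventually_elim simp
  then obtain n0 where n0: "\<And>n. n \<ge> n0 \<Longrightarrow> R \<le> d1 n / \<sigma> n \<and> exp (- real n) \<le> real n powr (- D) \<and> 2 \<le> n"
    unfolding eventually_sequentially by blast
  show "\<exists>n0 :: nat. \<forall>n \<ge> n0. measure (M n) {\<omega> \<in> space (M n). ext_ratio (t1 n \<omega>) (t2 n \<omega>) \<ge> ereal (1 + c / 2)}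
       \<ge> 1 - real n powr (- D)
     \<and> (\<forall>v1 vhat1.
          unit_eigenvector (E_Z n) v1 (d1 n) \<longrightarrow>
          (\<forall>i < n. \<forall>j < n. v1 $ i = v1 $ j) \<longrightarrow>
          (\<forall>\<omega> \<in> space (M n). unit_eigenvector (Z n \<omega>) (vhat1 \<omega>) (t1 n \<omega>)) \<longrightarrow>
          (\<forall>i < n + p n. (\<lambda>\<omega>. vhat1 \<omega> $ i) \<in> borel_measurable (M n)) \<longrightarrow>
          measure (M n)
            {\<omega> \<in> space (M n).
               \<bar>sqrt (1 / real n) * \<bar>block_indicator n (p n) \<bullet> vhat1 \<omega>\<bar> - sqrt (1 / 2)\<bar>
                 \<le> sqrt (2 * \<sigma> n / d1 n)}
            \<ge> 1 - real n powr (- D))"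
  proof (intro exI[of _ n0] allI impI)
    fix n assume "n \<ge> n0"
    then have R: "R \<le> d1 n / \<sigma> n" and exp_le: "exp (- real n) \<le> real n powr (- D)" and n: "2 \<le> n"
      using n0 by auto
    then have n1: "n \<ge> 1" "0 < n" by auto
    interpret prob_space "M n" by (rule prob[OF n1(1)])
    note noise_n = noise[OF n1(1)] and means_n = means[OF n1(1), THEN conjunct1] means[OF n1(1), THEN conjunct2]
    \<comment> \<open>A positive dimension is required by the net in \<open>p\<close> coordinates
      and by the existence of an eigenvalue of \<open>S n\<close>.\<close>
    have "0 < real n powr (1 / C)" using n1 by simp
    then have p: "0 < p n" using C(2)[OF n1(1)] by linarith
    have Sn: "S n \<in> carrier_mat (p n) (p n)" "transpose_mat (S n) = S n"
      using iid_gaussian_noiseD(1,2)[OF noise_n n1(2)] by auto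
    have a_le: "a \<le> spectral_norm (S n)"
      by (rule spectral_norm_ge_eigenvalues[OF Sn p a(2)[OF n1(1)]])
    have \<sigma>: "0 < \<sigma> n" "\<sigma> n = spectral_norm (S n) * sqrt (real n + real (p n))"
    proof -
      show "0 < \<sigma> n" using sigma[OF n1(1)] by simp
      then have "\<sigma> n = sqrt ((\<sigma> n)\<^sup>2)" by simp
      then show "\<sigma> n = spectral_norm (S n) * sqrt (real n + real (p n))"
        using sigma[OF n1(1)] a(1) a_le by (simp add: real_sqrt_mult)
    qed
    have R_ge: "(4 + c) * (1 + c) * K / c \<le> d1 n / \<sigma> n" "8 * K\<^sup>2 / \<kappa>\<^sup>2 \<le> d1 n / \<sigma> n" "4 * K \<le> d1 n / \<sigma> n"
    proof -
      have "0 \<le> (4 + c) * (1 + c) * K / c" "0 \<le> 8 * K\<^sup>2 / \<kappa>\<^sup>2" "0 \<le> 4 * K" using K c_pos by auto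
      then show "(4 + c) * (1 + c) * K / c \<le> d1 n / \<sigma> n" "8 * K\<^sup>2 / \<kappa>\<^sup>2 \<le> d1 n / \<sigma> n" "4 * K \<le> d1 n / \<sigma> n"
        using R unfolding R_def by linarith+
    qed
    define \<delta> where "\<delta> = K * \<sigma> n"
    have \<delta>: "0 < \<delta>" using K \<sigma> by (simp add: \<delta>_def)
    have \<delta>_small: "(4 + c) * (1 + c) * \<delta> \<le> c * d1 n" "4 * \<delta> \<le> d1 n"
      using R_ge(1,3) c_pos \<sigma>(1) by (simp_all add: \<delta>_def field_simps)
    then have d1_pos: "0 < d1 n" using \<delta> by linarith
    have X_fun: "X n = data_matrix n (p n) (Y n) (\<mu>1 n) (\<mu>2 n) (w n)" by (rule ext) (rule X)
    have E: "E_X n \<in> carrier_mat (p n) n" by (simp add: E_X)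
    have Xc: "X n \<omega> \<in> carrier_mat (p n) n" for \<omega> by (simp add: X)
    have EZ: "E_Z n = symmetric_dilation (E_X n)"
      unfolding E_Z E_X X_fun Z[abs_def] X
      by (rule expectation_symmetric_dilation[OF prob[OF n1(1)] noise_n means_n])
    have d1: "d1 n = singular_value (E_X n) 1" and d2: "d2 n = singular_value (E_X n) 2" using d by auto
    have t1: "t1 n \<omega> = singular_value (X n \<omega>) 1" and t2: "t2 n \<omega> = singular_value (X n \<omega>) 2" for \<omega>
      using t by auto
    have gap_n: "(1 + c) * d2 n \<le> d1 n"
      by (rule ext_ratio_geD[OF gap[OF n1(1)] _ less_imp_le[OF d1_pos]])
         (simp add: d2 singular_value_2_nonneg[OF E n])
    obtain G where G: "G \<in> events" "1 - exp (- (real n + real (p n))) \<le> prob G"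
      "\<And>\<omega> x. \<omega> \<in> G \<Longrightarrow> x \<in> carrier_vec n \<Longrightarrow>
        vec_l2 (noise_matrix n (p n) (w n) \<omega> *\<^sub>v x) \<le> K * (spectral_norm (S n) * sqrt (real n + real (p n))) * vec_l2 x"
      using noise_matrix_operator_bound[OF noise_n n1(2) p a(1) a_le] unfolding K_def by blast
    have G_space: "\<omega> \<in> space (M n)" if "\<omega> \<in> G" for \<omega>
      using sets.sets_into_space[OF G(1)] that by blast
    have XE: "vec_l2 ((X n \<omega> - E_X n) *\<^sub>v x) \<le> \<delta> * vec_l2 x" if "\<omega> \<in> G" "x \<in> carrier_vec n" for \<omega> x
      using G(3)[OF that] data_matrix_minus_expectation[OF prob[OF n1(1)] noise_n means_n G_space[OF that(1)], of "Y n"]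
      by (simp add: X_fun E_X \<delta>_def \<sigma>(2))
    then have EX: "vec_l2 ((E_X n - X n \<omega>) *\<^sub>v x) \<le> \<delta> * vec_l2 x" if "\<omega> \<in> G" "x \<in> carrier_vec n" for \<omega> x
      using that vec_l2_minus_mat_commute[OF E Xc] by metis
    have t1_ge: "d1 n - \<delta> \<le> t1 n \<omega>" and t2_le: "t2 n \<omega> \<le> d2 n + \<delta>" if "\<omega> \<in> G" for \<omega>
      using singular_value_perturb[OF E Xc n EX[OF that], of 1] singular_value_perturb[OF Xc E n XE[OF that], of 2]
      by (simp_all add: d1 d2 t1 t2)
    have t1_pos: "0 < t1 n \<omega>" if "\<omega> \<in> G" for \<omega>
      using t1_ge[OF that] \<delta> \<delta>_small by linarith
    \<comment> \<open>Each claim is reduced to an inclusion of \<open>G\<close> in the event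
      concerned. Monotonicity of the measure requires that event to be measurable, whence the
      measurability arguments below.\<close>
    have prob_ge: "1 - real n powr (- D) \<le> prob B" if B: "B \<in> events" "G \<subseteq> B" for B
    proof -
      have "exp (- (real n + real (p n))) \<le> exp (- real n)" by simp
      then have "1 - real n powr (- D) \<le> prob G" using G(2) exp_le by linarith
      also have "\<dots> \<le> prob B" using B by (intro finite_measure_mono)
      finally show ?thesis .
    qed
    have meas [measurable]: "t1 n \<in> borel_measurable (M n)" "t2 n \<in> borel_measurable (M n)"
    proof -
      have sv: "(\<lambda>\<omega>. singular_value (X n \<omega>) k) \<in> borel_measurable (M n)" if "k \<in> {1, 2}" for k
        by (rule singular_value_measurable[OF Xc _ n that])
           (simp add: X_fun data_matrix_entry_measurable[OF prob[OF n1(1)] noise_n means_n])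
      show "t1 n \<in> borel_measurable (M n)" "t2 n \<in> borel_measurable (M n)"
        using sv[of 1] sv[of 2] unfolding t1[symmetric] t2[symmetric] by simp_all
    qed
    have "G \<subseteq> {\<omega> \<in> space (M n). ereal (1 + c / 2) \<le> ext_ratio (t1 n \<omega>) (t2 n \<omega>)}"
    proof clarify
      fix \<omega> assume \<omega>: "\<omega> \<in> G"
      have "(1 + c / 2) * t2 n \<omega> \<le> t1 n \<omega>"
        by (rule ratio_perturb[OF c_pos gap_n t1_ge[OF \<omega>] t2_le[OF \<omega>] \<delta>_small(1)])
      then show "\<omega> \<in> space (M n) \<and> ereal (1 + c / 2) \<le> ext_ratio (t1 n \<omega>) (t2 n \<omega>)"
        using G_space[OF \<omega>] t1_pos[OF \<omega>] singular_value_2_nonneg[OF Xc n] by (auto intro!: ext_ratio_geI simp: t2)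
    qed
    then have part1: "1 - real n powr (- D)
        \<le> prob {\<omega> \<in> space (M n). ereal (1 + c / 2) \<le> ext_ratio (t1 n \<omega>) (t2 n \<omega>)}"
      by (rule prob_ge[rotated]) (simp add: ext_ratio_def)
    moreover have "1 - real n powr (- D) \<le> prob {\<omega> \<in> space (M n).
        \<bar>sqrt (1 / real n) * \<bar>block_indicator n (p n) \<bullet> vhat1 \<omega>\<bar> - sqrt (1 / 2)\<bar> \<le> sqrt (2 * \<sigma> n / d1 n)}"
      if v1: "unit_eigenvector (E_Z n) v1 (d1 n)" "\<forall>i<n. \<forall>j<n. v1 $ i = v1 $ j"
        and vhat: "\<forall>\<omega>\<in>space (M n). unit_eigenvector (Z n \<omega>) (vhat1 \<omega>) (t1 n \<omega>)"
        and vhat_meas: "\<forall>i<n + p n. (\<lambda>\<omega>. vhat1 \<omega> $ i) \<in> borel_measurable (M n)"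
      for v1 vhat1
    proof (rule prob_ge)
      have "(\<lambda>\<omega>. \<Sum>i = 0..<n + p n. block_indicator n (p n) $ i * vhat1 \<omega> $ i) \<in> borel_measurable (M n)"
        using vhat_meas by (intro borel_measurable_sum borel_measurable_times) auto
      moreover have "(\<Sum>i = 0..<n + p n. block_indicator n (p n) $ i * vhat1 \<omega> $ i) = block_indicator n (p n) \<bullet> vhat1 \<omega>"
        if "\<omega> \<in> space (M n)" for \<omega>
      proof -
        \<comment> \<open>The scalar product sums over the dimension of its second argument, which
          the eigenvector property fixes.\<close>
        have "dim_vec (vhat1 \<omega>) = n + p n"
          using vhat that carrier_matD[OF Xc[of \<omega>]]
          by (auto simp: unit_eigenvector_def eigenvector_def Z symmetric_dilation_def)
        then show ?thesis by (simp add: scalar_prod_def)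
      qed
      ultimately have [measurable]: "(\<lambda>\<omega>. block_indicator n (p n) \<bullet> vhat1 \<omega>) \<in> borel_measurable (M n)"
        by (rule measurable_cong[THEN iffD1, rotated])
      show "{\<omega> \<in> space (M n). \<bar>sqrt (1 / real n) * \<bar>block_indicator n (p n) \<bullet> vhat1 \<omega>\<bar> - sqrt (1 / 2)\<bar>
          \<le> sqrt (2 * \<sigma> n / d1 n)} \<in> events"
        by measurable
      show "G \<subseteq> {\<omega> \<in> space (M n). \<bar>sqrt (1 / real n) * \<bar>block_indicator n (p n) \<bullet> vhat1 \<omega>\<bar> - sqrt (1 / 2)\<bar>
          \<le> sqrt (2 * \<sigma> n / d1 n)}"
      proof clarify
        fix \<omega> assume \<omega>: "\<omega> \<in> G"
        have "unit_eigenvector (symmetric_dilation (X n \<omega>)) (vhat1 \<omega>) (singular_value (X n \<omega>) 1)"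
          using vhat G_space[OF \<omega>] by (simp add: Z t1)
        then have "\<bar>sqrt (1 / real n) * \<bar>block_indicator n (p n) \<bullet> vhat1 \<omega>\<bar> - sqrt (1 / 2)\<bar> \<le> 4 * \<delta> / (\<kappa> * d1 n)"
          unfolding \<kappa>_def d1 using v1 gap_n \<delta>_small(2) \<delta> d1_pos t1_pos[OF \<omega>] XE[OF \<omega>]
          by (intro top_eigenvector_overlap[OF E Xc n]) (simp_all add: EZ d1 d2 t1 c_pos)
        also have "\<dots> \<le> sqrt (2 * \<sigma> n / d1 n)"
          unfolding \<delta>_def by (rule overlap_bound_le_sqrt[OF K \<kappa> \<sigma>(1) d1_pos R_ge(2)])
        finally show "\<omega> \<in> space (M n) \<and> \<bar>sqrt (1 / real n) * \<bar>block_indicator n (p n) \<bullet> vhat1 \<omega>\<bar> - sqrt (1 / 2)\<bar>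
            \<le> sqrt (2 * \<sigma> n / d1 n)"
          using G_space[OF \<omega>] by simp
      qed
    qed
    ultimately show "measure (M n) {\<omega> \<in> space (M n). ext_ratio (t1 n \<omega>) (t2 n \<omega>) \<ge> ereal (1 + c / 2)}
       \<ge> 1 - real n powr (- D)
     \<and> (\<forall>v1 vhat1.
          unit_eigenvector (E_Z n) v1 (d1 n) \<longrightarrow>
          (\<forall>i < n. \<forall>j < n. v1 $ i = v1 $ j) \<longrightarrow>
          (\<forall>\<omega> \<in> space (M n). unit_eigenvector (Z n \<omega>) (vhat1 \<omega>) (t1 n \<omega>)) \<longrightarrow>
          (\<forall>i < n + p n. (\<lambda>\<omega>. vhat1 \<omega> $ i) \<in> borel_measurable (M n)) \<longrightarrow>
          measure (M n)
            {\<omega> \<in> space (M n).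
               \<bar>sqrt (1 / real n) * \<bar>block_indicator n (p n) \<bullet> vhat1 \<omega>\<bar> - sqrt (1 / 2)\<bar>
                 \<le> sqrt (2 * \<sigma> n / d1 n)}
            \<ge> 1 - real n powr (- D))"
      by blast
  qed
qed

end
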